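(* Let $\mathbb{D}=\mathbb{R},\mathbb{C}$ or $\mathbb{H}$, and let $A\in\mathrm{GL}(n,\mathbb{D})$, with Jordan form over $\mathbb{D}$ as described in the context. Consider the finite collection (with multiplicity) of Jordan blocks of $A$, where a block is identified with any matrix of the same size conjugate to it by an invertible matrix over $\mathbb{D}$. Then $A$ is reversible in $\mathrm{GL}(n,\mathbb{D})$ if and only if the following holds: (1) For $\mathbb{D}=\mathbb{R}$: the blocks can be partitioned into pairs of the form $\{\mathrm{J}_{\mathbb{R}}(\mu\pm\mathbf{i}\nu,2t),\ \mathrm{J}_{\mathbb{R}}(\frac{\mu}{\mu^2+\nu^2}\mp\mathbf{i}\frac{\nu}{\mu^2+\nu^2},2t)\}$ or $\{\mathrm{J}(\lambda,s),\mathrm{J}(\lambda^{-1},s)\}$, or singletons of the form $\{\mathrm{J}_{\mathbb{R}}(\alpha\pm\mathbf{i}\beta,2\ell)\}$ or $\{\mathrm{J}(\gamma,m)\}$, where $\lambda,\mu,\nu,\alpha,\beta,\gamma\in\mathbb{R}$ are such that $\lambda,\gamma\neq 0$, $\nu,\beta>0$, $\lambda\neq\pm1$, $\mu^2+\nu^2\neq 1$, $\gamma=\pm1$ and $\alpha^2+\beta^2=1$. (2) For $\mathbb{D}=\mathbb{C}$: the blocks can be partitioned into pairs of the form $\{\mathrm{J}(\lambda,s),\mathrm{J}(\lambda^{-1},s)\}$ or singletons of the form $\{\mathrm{J}(\mu,m)\}$, where $\lambda,\mu\in\mathbb{C}\setminus\{0\}$, $\lambda\neq\pm1$ and $\mu=\pm1$.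 (3) For $\mathbb{D}=\mathbb{H}$: the blocks can be partitioned into pairs of the form $\{\mathrm{J}(\lambda,s),\mathrm{J}(\lambda^{-1},s)\}$ or singletons of the form $\{\mathrm{J}(\mu,m)\}$, where $\lambda,\mu\in\mathbb{C}\setminus\{0\}$ have non-negative imaginary parts, $|\lambda|\neq1$ and $|\mu|=1$. (The parameters may differ from one pair or singleton to another.)
   Context: $\mathbb{H}=\mathbb{R}+\mathbb{R}\mathbf{i}+\mathbb{R}\mathbf{j}+\mathbb{R}\mathbf{k}$ denotes the quaternions, with $\mathbb{C}=\mathbb{R}+\mathbb{R}\mathbf{i}\subset\mathbb{H}$. An element $g$ of a group $G$ is reversible in $G$ if $hgh^{-1}=g^{-1}$ for some $h\in G$. Jordan blocks: $\mathrm{J}(\lambda,m)$ is the $m\times m$ matrix with $\lambda$ on the diagonal, $1$ on all superdiagonal entries, and $0$ elsewhere. Let $\psi(z)=\begin{pmatrix}\mathrm{Re}(z)&\mathrm{Im}(z)\\-\mathrm{Im}(z)&\mathrm{Re}(z)\end{pmatrix}$ for $z\in\mathbb{C}$ and let $\Psi:\mathrm{M}(n,\mathbb{C})\to\mathrm{M}(2n,\mathbb{R})$ replace each entry $z$ by the $2\times 2$ block $\psi(z)$. For $\mu,\nu\in\mathbb{R}$ with $\nu>0$, $\mathrm{J}_{\mathbb{R}}(\mu\pm\mathbf{i}\nu,2n):=\Psi(\mathrm{J}(\mu+\mathbf{i}\nu,n))$ and $\mathrm{J}_{\mathbb{R}}(\mu\mp\mathbf{i}\nu,2n):=\Psi(\mathrm{J}(\mu-\mathbf{i}\nu,n))\in\mathrm{M}(2n,\mathbb{R})$;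 these two matrices are conjugate in $\mathrm{GL}(2n,\mathbb{R})$. Jordan form: every matrix in $\mathrm{M}(n,\mathbb{D})$ is conjugate under $\mathrm{GL}(n,\mathbb{D})$ to a block diagonal matrix, unique up to permutation of the blocks, whose diagonal blocks are: for $\mathbb{D}=\mathbb{R}$, blocks $\mathrm{J}(\lambda,m)$ with $\lambda\in\mathbb{R}$ and $\mathrm{J}_{\mathbb{R}}(\mu\pm\mathbf{i}\nu,2\ell)$ with $\mu,\nu\in\mathbb{R}$, $\nu>0$; for $\mathbb{D}=\mathbb{C}$, blocks $\mathrm{J}(\lambda,m)$ with $\lambda\in\mathbb{C}$; for $\mathbb{D}=\mathbb{H}$, blocks $\mathrm{J}(\lambda,m)$ with $\lambda\in\mathbb{C}$ having non-negative imaginary part. These are the Jordan blocks of the matrix. Over $\mathbb{H}$, $\mathrm{J}(\lambda,m)$ and $\mathrm{J}(\overline{\lambda},m)$ are conjugate for $\lambda\in\mathbb{C}$. *)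

theory Defs
  imports
    "HOL-Library.Disjoint_Sets"
    "HOL-Algebra.Group"
    "Jordan_Normal_Form.Jordan_Normal_Form"
begin

(* Quat a b c d stands for a + b i + c j + d k. *)
datatype quat = Quat (QRe: real) (QI: real) (QJ: real) (QK: real)

instantiation quat :: division_ring
begin

definition "0 = Quat 0 0 0 0"
definition "1 = Quat 1 0 0 0"
definition "x + y = Quat (QRe x + QRe y) (QI x + QI y) (QJ x + QJ y) (QK x + QK y)"
definition "- x = Quat (- QRe x) (- QI x) (- QJ x) (- QK x)"
definition "x - y = Quat (QRe x - QRe y) (QI x - QI y) (QJ x - QJ y) (QK x - QK y)"
definition "x * y = Quat
  (QRe x * QRe y - QI x * QI y - QJ x * QJ y - QK x * QK y)
  (QRe x * QI y + QI x * QRe y + QJ x * QK y - QK x * QJ y)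
  (QRe x * QJ y - QI x * QK y + QJ x * QRe y + QK x * QI y)
  (QRe x * QK y + QI x * QJ y - QJ x * QI y + QK x * QRe y)"
definition "inverse x =
  (let r = QRe x ^ 2 + QI x ^ 2 + QJ x ^ 2 + QK x ^ 2
   in Quat (QRe x / r) (- QI x / r) (- QJ x / r) (- QK x / r))"
definition "x div (y::quat) = x * inverse y"

lemmas quat_ops_defs = zero_quat_def one_quat_def plus_quat_def uminus_quat_def
  minus_quat_def times_quat_def

instance
proof
  fix x y z :: quat
  show "x + y + z = x + (y + z)" "x + y = y + x" "0 + x = x" "- x + x = 0" "x - y = x + - y"
    by (simp_all add: quat_ops_defs algebra_simps)
  show "x * y * z = x * (y * z)" "(x + y) * z = x * z + y * z" "x * (y + z) = x * y + x * z"
    by (simp_all add: quat_ops_defs algebra_simps)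
  show "1 * x = x" "x * 1 = x" "(0::quat) \<noteq> 1"
    by (simp_all add: quat_ops_defs)
  show "inverse (0::quat) = 0"
    by (simp add: inverse_quat_def quat_ops_defs)
  show "x div y = x * inverse y"
    by (simp add: divide_quat_def)
next
  fix x :: quat
  assume "x \<noteq> 0"
  define r where "r = QRe x ^ 2 + QI x ^ 2 + QJ x ^ 2 + QK x ^ 2"
  have r: "r \<noteq> 0"
  proof
    assume "r = 0"
    then have "QRe x = 0" "QI x = 0" "QJ x = 0" "QK x = 0"
      unfolding r_def by (smt (verit) zero_le_power2 power2_eq_iff power_zero_numeral zero_eq_power2)+
    with \<open>x \<noteq> 0\<close> show False
      by (cases x) (simp add: zero_quat_def)
  qed
  have inv: "inverse x = Quat (QRe x / r) (- QI x / r) (- QJ x / r) (- QK x / r)"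
    by (simp add: inverse_quat_def r_def Let_def)
  have s: "(QRe x * QRe x + QI x * QI x + QJ x * QJ x + QK x * QK x) / r = 1"
    using r by (simp add: r_def power2_eq_square)
  show "inverse x * x = 1" "x * inverse x = 1"
    unfolding inv times_quat_def one_quat_def using s
    by (simp_all add: add_divide_distrib mult.commute)
qed

end

definition quat_of_complex :: "complex \<Rightarrow> quat"
  where "quat_of_complex z = Quat (Re z) (Im z) 0 0"

definition reversible :: "('a, 'b) monoid_scheme \<Rightarrow> 'a \<Rightarrow> bool"
  where "reversible G g \<longleftrightarrow>
    (\<exists>h\<in>carrier G. h \<otimes>\<^bsub>G\<^esub> g \<otimes>\<^bsub>G\<^esub> inv\<^bsub>G\<^esub> h = inv\<^bsub>G\<^esub> g)"

definition GL :: "nat \<Rightarrow> 'a::semiring_1 mat monoid"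
  where "GL n = units_of (ring_mat TYPE('a) n ())"

definition psi :: "complex \<Rightarrow> real mat"
  where "psi z = mat_of_rows_list 2 [[Re z, Im z], [- Im z, Re z]]"

definition Psi :: "complex mat \<Rightarrow> real mat"
  where "Psi A = mat (2 * dim_row A) (2 * dim_col A)
    (\<lambda>(i, j). psi (A $$ (i div 2, j div 2)) $$ (i mod 2, j mod 2))"

(* The first argument is half of the size of the block. *)
definition real_jordan_pm :: "nat \<Rightarrow> real \<Rightarrow> real \<Rightarrow> real mat"
  where "real_jordan_pm l \<mu> \<nu> = Psi (jordan_block l (Complex \<mu> \<nu>))"

definition real_jordan_mp :: "nat \<Rightarrow> real \<Rightarrow> real \<Rightarrow> real mat"
  where "real_jordan_mp l \<mu> \<nu> = Psi (jordan_block l (Complex \<mu> (- \<nu>)))"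

definition blocks_R :: "real mat set"
  where "blocks_R = {jordan_block m a | m a. m > 0} \<union>
    {real_jordan_pm l \<mu> \<nu> | l \<mu> \<nu>. l > 0 \<and> \<nu> > 0}"

definition blocks_C :: "complex mat set"
  where "blocks_C = {jordan_block m a | m a. m > 0}"

definition blocks_H :: "quat mat set"
  where "blocks_H = {jordan_block m (quat_of_complex a) | m a. m > 0 \<and> Im a \<ge> 0}"

(* Bs lists, with multiplicity, the Jordan blocks of A; \<B> is the set of admissible blocks.
   Such a list exists for every square A and is unique up to permutation. *)
definition jordan_form :: "'a::semiring_1 mat set \<Rightarrow> 'a mat \<Rightarrow> 'a mat list \<Rightarrow> bool"
  where "jordan_form \<B> A Bs \<longleftrightarrow> set Bs \<subseteq> \<B> \<and> similar_mat A (diag_block_mat Bs)"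

(* Positions in the list, rather than matrices, are partitioned, so that equal blocks
   count with multiplicity. *)
definition pairs_and_singletons ::
    "('a \<Rightarrow> 'a \<Rightarrow> bool) \<Rightarrow> ('a \<Rightarrow> bool) \<Rightarrow> 'a list \<Rightarrow> bool"
  where "pairs_and_singletons pair single Bs \<longleftrightarrow>
    (\<exists>P. partition_on {..<length Bs} P \<and>
      (\<forall>p\<in>P. (\<exists>i j. p = {i, j} \<and> i \<noteq> j \<and> pair (Bs ! i) (Bs ! j)) \<or>
              (\<exists>i. p = {i} \<and> single (Bs ! i))))"

(* Blocks are matched with the displayed forms up to similarity; for instance
   real_jordan_mp blocks, and quaternionic blocks with Im < 0, are not in the
   normalised lists above but are similar to ones that are. *)

definition pair_R :: "real mat \<Rightarrow> real mat \<Rightarrow> bool"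
  where "pair_R X Y \<longleftrightarrow>
    (\<exists>\<mu> \<nu> t. \<nu> > 0 \<and> \<mu>\<^sup>2 + \<nu>\<^sup>2 \<noteq> 1 \<and>
      similar_mat X (real_jordan_pm t \<mu> \<nu>) \<and>
      similar_mat Y (real_jordan_mp t (\<mu> / (\<mu>\<^sup>2 + \<nu>\<^sup>2)) (\<nu> / (\<mu>\<^sup>2 + \<nu>\<^sup>2)))) \<or>
    (\<exists>a s. a \<noteq> 0 \<and> a \<noteq> 1 \<and> a \<noteq> - 1 \<and>
      similar_mat X (jordan_block s a) \<and> similar_mat Y (jordan_block s (inverse a)))"

definition single_R :: "real mat \<Rightarrow> bool"
  where "single_R X \<longleftrightarrow>
    (\<exists>\<alpha> \<beta> l. \<beta> > 0 \<and> \<alpha>\<^sup>2 + \<beta>\<^sup>2 = 1 \<and> similar_mat X (real_jordan_pm l \<alpha> \<beta>)) \<or>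
    (\<exists>\<gamma> m. (\<gamma> = 1 \<or> \<gamma> = - 1) \<and> similar_mat X (jordan_block m \<gamma>))"

definition pair_C :: "complex mat \<Rightarrow> complex mat \<Rightarrow> bool"
  where "pair_C X Y \<longleftrightarrow>
    (\<exists>a s. a \<noteq> 0 \<and> a \<noteq> 1 \<and> a \<noteq> - 1 \<and>
      similar_mat X (jordan_block s a) \<and> similar_mat Y (jordan_block s (inverse a)))"

definition single_C :: "complex mat \<Rightarrow> bool"
  where "single_C X \<longleftrightarrow>
    (\<exists>\<mu> m. (\<mu> = 1 \<or> \<mu> = - 1) \<and> similar_mat X (jordan_block m \<mu>))"

definition pair_H :: "quat mat \<Rightarrow> quat mat \<Rightarrow> bool"
  where "pair_H X Y \<longleftrightarrow>
    (\<exists>a s. a \<noteq> 0 \<and> Im a \<ge> 0 \<and> cmod a \<noteq> 1 \<and>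
      similar_mat X (jordan_block s (quat_of_complex a)) \<and>
      similar_mat Y (jordan_block s (quat_of_complex (inverse a))))"

definition single_H :: "quat mat \<Rightarrow> bool"
  where "single_H X \<longleftrightarrow>
    (\<exists>\<mu> m. \<mu> \<noteq> 0 \<and> Im \<mu> \<ge> 0 \<and> cmod \<mu> = 1 \<and>
      similar_mat X (jordan_block m (quat_of_complex \<mu>)))"

end

theory Submission
  imports Defs "Jordan_Normal_Form.Jordan_Normal_Form_Uniqueness"
begin

text \<open>
  \<open>A\<close> is reversible iff it is similar to its inverse. Label every Jordan block by its size and
  eigenvalue \<open>(m, z)\<close>, with \<open>Im z \<ge> 0\<close> over the reals and the quaternions. The inverse of a block is
  similar to the block labelled \<open>\<sigma> (m, z)\<close>, which is \<open>(m, 1/z)\<close> over the complex numbers and \<open>(m, 1/cnj z)\<close>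
  otherwise. By uniqueness of the Jordan form, \<open>A\<close> is therefore reversible iff the multiset of its
  labels is invariant under the involution \<open>\<sigma>\<close>; the pairs are the orbits of two labels, and the
  singletons are the fixed points. Uniqueness over the reals and the quaternions is inherited from
  the complex numbers along complexification and along the embedding of quaternions into complex
  2x2 matrices: both turn a block with non-real eigenvalue \<open>z\<close> into the blocks of \<open>z\<close> and
  \<open>cnj z\<close>.
\<close>

section \<open>Matrices with similar inverses\<close>

text \<open>Quaternionic entries do not commute, so determinants are confined to matrices over
  fields. The general lemmas therefore hold over any \<open>semiring_1\<close>, and
  \<open>inverse_similar\<close> carries a two-sided inverse of \<open>X\<close> as a witness
  instead of presupposing an inverse operation. Facts that do rest on determinants are proved over
  fields and then carried over by multiplicative unital maps. The conjugation in
  \<open>\<sigma>\<close> is a normalisation: \<open>1/z\<close> leaves the closed upper half plane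
  when \<open>z\<close> is not real, while over the reals and the quaternions conjugate eigenvalues
  give similar blocks, so \<open>1/cnj z\<close> labels the same inverse and stays in the half
  plane. Its fixed points fill the unit circle, whereas \<open>1/z\<close> fixes only
  \<open>1\<close> and \<open>-1\<close>; this accounts for the different singletons in the three
  cases. The eigenvalue 0 needs care: as \<open>inverse 0 = 0\<close>, it would be a spurious fixed
  point of \<open>\<sigma>\<close>. Invertibility of \<open>A\<close> must exclude it before blocks
  are matched.\<close>

definition inverse_similar :: "'a::semiring_1 mat \<Rightarrow> 'a mat \<Rightarrow> bool"
  where "inverse_similar X Y \<longleftrightarrow>
    (\<exists>n Z. X \<in> carrier_mat n n \<and> Z \<in> carrier_mat n n \<and> X * Z = 1\<^sub>m n \<and> Z * X = 1\<^sub>m n \<and>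
      similar_mat Z Y)"

lemma inverse_similarI:
  assumes "X \<in> carrier_mat n n" "Z \<in> carrier_mat n n" "X * Z = 1\<^sub>m n" "Z * X = 1\<^sub>m n"
    and "similar_mat Z Y"
  shows "inverse_similar X Y"
  using assms unfolding inverse_similar_def by blast

lemma inverse_similarE:
  assumes "inverse_similar X Y"
  obtains n Z where "X \<in> carrier_mat n n" "Z \<in> carrier_mat n n" "Y \<in> carrier_mat n n"
    "X * Z = 1\<^sub>m n" "Z * X = 1\<^sub>m n" "similar_mat Z Y"
proof -
  obtain n Z where Z: "X \<in> carrier_mat n n" "Z \<in> carrier_mat n n" "X * Z = 1\<^sub>m n" "Z * X = 1\<^sub>m n"
    "similar_mat Z Y"
    using assms unfolding inverse_similar_def by blast
  moreover have "Y \<in> carrier_mat n n"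
    using Z(5) similar_mat_witD2(5)[OF Z(2)] unfolding similar_mat_def by blast
  ultimately show thesis using that by blast
qed

lemma inverse_similar_trans:
  "inverse_similar X Y \<Longrightarrow> similar_mat Y Y' \<Longrightarrow> inverse_similar X Y'"
  unfolding inverse_similar_def using similar_mat_trans by blast

text \<open>If \<open>Y = P * Z * Q\<close> with \<open>Z\<close> inverse to \<open>X\<close> and
  \<open>Q\<close> inverse to \<open>P\<close>, then \<open>P * X * Q\<close> inverts
  \<open>Y\<close> and is similar to \<open>X\<close>. Symmetry makes the order inside a pair of
  blocks immaterial.\<close>

lemma inverse_similar_sym:
  assumes "inverse_similar X Y"
  shows "inverse_similar Y X"
proof -
  obtain n Z where X: "X \<in> carrier_mat n n" and Z: "Z \<in> carrier_mat n n" and Y: "Y \<in> carrier_mat n n"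
    and XZ: "X * Z = 1\<^sub>m n" and ZX: "Z * X = 1\<^sub>m n" and sim: "similar_mat Z Y"
    using assms by (rule inverse_similarE)
  obtain P Q where w: "similar_mat_wit Y Z P Q"
    using similar_mat_sym[OF sim] unfolding similar_mat_def by blast
  note d = similar_mat_witD2[OF Y w]
  have cP: "P \<in> carrier_mat n n" and cQ: "Q \<in> carrier_mat n n"
    and PQ: "P * Q = 1\<^sub>m n" and QP: "Q * P = 1\<^sub>m n" and YP: "Y = P * Z * Q"
    using d by auto
  note [simp] = assoc_mult_mat[of _ n n _ n _ n]
  have cancel: "U * V = 1\<^sub>m n \<Longrightarrow> U * (V * W) = W"
    if "U \<in> carrier_mat n n" "V \<in> carrier_mat n n" "W \<in> carrier_mat n n" for U V W :: "'a mat"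
    using that assoc_mult_mat[of U n n V n W n] by simp
  show ?thesis
  proof (rule inverse_similarI)
    show "Y \<in> carrier_mat n n" by fact
    show "P * X * Q \<in> carrier_mat n n" using cP cQ X by simp
    show "Y * (P * X * Q) = 1\<^sub>m n" "P * X * Q * Y = 1\<^sub>m n"
      unfolding YP using cP cQ X Z cancel[OF cQ cP _ QP] cancel[OF Z X _ ZX] cancel[OF X Z _ XZ]
      by (simp_all add: PQ)
    show "similar_mat (P * X * Q) X"
      by (rule similar_matI[of _ _ P Q n]) (use cP cQ X PQ QP in auto)
  qed
qed

lemma inverse_similar_trans_left:
  "similar_mat X X' \<Longrightarrow> inverse_similar X Y \<Longrightarrow> inverse_similar X' Y"
  using inverse_similar_sym inverse_similar_trans by blast

text \<open>Inverses are unique, and both matrices are similar to the one inverse of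
  \<open>X\<close>. This turns two descriptions of the inverse by blocks into a similarity, to which
  uniqueness of the Jordan form applies.\<close>

lemma inverse_similar_unique:
  assumes "inverse_similar X Y" "inverse_similar X Y'"
  shows "similar_mat Y Y'"
proof -
  obtain n Z where X: "X \<in> carrier_mat n n" and Z: "Z \<in> carrier_mat n n"
    and ZX: "Z * X = 1\<^sub>m n" and sim: "similar_mat Z Y"
    using assms(1) by (rule inverse_similarE)
  obtain n' Z' where X': "X \<in> carrier_mat n' n'" and Z': "Z' \<in> carrier_mat n' n'"
    and XZ': "X * Z' = 1\<^sub>m n'" and sim': "similar_mat Z' Y'"
    using assms(2) by (rule inverse_similarE)
  have [simp]: "n' = n" using X X' by auto
  have "Z = Z * (X * Z')" using Z XZ' by simp
  also have "\<dots> = (Z * X) * Z'" using Z X Z' by simp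
  also have "\<dots> = Z'" using ZX Z' by simp
  finally show ?thesis using sim sim' similar_mat_sym similar_mat_trans by blast
qed

section \<open>Block diagonal matrices: inverses, similarity and reordering\<close>

lemma inverse_similar_four_block:
  assumes "inverse_similar X Y" "inverse_similar X' Y'"
    and "dim_row X = n" "dim_row X' = m"
  shows "inverse_similar (four_block_mat X (0\<^sub>m n m) (0\<^sub>m m n) X')
    (four_block_mat Y (0\<^sub>m n m) (0\<^sub>m m n) Y')"
proof -
  obtain Z where X: "X \<in> carrier_mat n n" "Z \<in> carrier_mat n n" "Y \<in> carrier_mat n n"
    "X * Z = 1\<^sub>m n" "Z * X = 1\<^sub>m n" "similar_mat Z Y"
    using assms(1,3) by (metis inverse_similarE carrier_matD(1))
  obtain Z' where X': "X' \<in> carrier_mat m m" "Z' \<in> carrier_mat m m" "Y' \<in> carrier_mat m m"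
    "X' * Z' = 1\<^sub>m m" "Z' * X' = 1\<^sub>m m" "similar_mat Z' Y'"
    using assms(2,4) by (metis inverse_similarE carrier_matD(1))
  show ?thesis
  proof (rule inverse_similarI)
    show "similar_mat (four_block_mat Z (0\<^sub>m n m) (0\<^sub>m m n) Z')
        (four_block_mat Y (0\<^sub>m n m) (0\<^sub>m m n) Y')"
      by (rule similar_mat_four_block_0_0) (use X X' in auto)
    show "four_block_mat X (0\<^sub>m n m) (0\<^sub>m m n) X' * four_block_mat Z (0\<^sub>m n m) (0\<^sub>m m n) Z'
        = 1\<^sub>m (n + m)"
      by (subst mult_four_block_mat[of _ n n _ m _ m _ _ n _ m]) (use X X' in auto)
    show "four_block_mat Z (0\<^sub>m n m) (0\<^sub>m m n) Z' * four_block_mat X (0\<^sub>m n m) (0\<^sub>m m n) X'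
        = 1\<^sub>m (n + m)"
      by (subst mult_four_block_mat[of _ n n _ m _ m _ _ n _ m]) (use X X' in auto)
  qed (use X X' in auto)
qed

lemma inverse_similar_diag_block_mat:
  assumes "list_all2 inverse_similar Xs Ys"
  shows "inverse_similar (diag_block_mat Xs) (diag_block_mat Ys)"
  using assms
proof (induction rule: list_all2_induct)
  case Nil
  have "similar_mat (0\<^sub>m 0 0) (0\<^sub>m 0 0 :: 'a mat)" by (rule similar_mat_refl[of _ 0]) simp
  then show ?case by (auto intro!: inverse_similarI[of _ 0 "0\<^sub>m 0 0"])
next
  case (Cons X Xs Y Ys)
  obtain n where "X \<in> carrier_mat n n" "Y \<in> carrier_mat n n"
    using Cons.hyps by (metis inverse_similarE)
  moreover obtain m where "diag_block_mat Xs \<in> carrier_mat m m" "diag_block_mat Ys \<in> carrier_mat m m"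
    using Cons.IH by (metis inverse_similarE)
  ultimately show ?case
    using inverse_similar_four_block[OF Cons.hyps(1) Cons.IH, of n m] by (auto simp: Let_def)
qed

lemma similar_diag_block_mat:
  assumes "list_all2 similar_mat Xs Ys"
  shows "similar_mat (diag_block_mat Xs) (diag_block_mat Ys)"
  using similar_diag_mat_block_mat[of "zip Xs Ys"] assms
  by (auto simp: list_all2_iff)

text \<open>Conjugation by the block permutation matrix \<open>P\<close>, whose inverse
  \<open>Q\<close> is the opposite block permutation.\<close>

lemma similar_four_block_swap:
  assumes "A \<in> carrier_mat n n" "B \<in> carrier_mat m m"
  shows "similar_mat (four_block_mat A (0\<^sub>m n m) (0\<^sub>m m n) B)
    (four_block_mat B (0\<^sub>m m n) (0\<^sub>m n m) A)"
proof -
  define P :: "'a mat" where "P = four_block_mat (0\<^sub>m n m) (1\<^sub>m n) (1\<^sub>m m) (0\<^sub>m m n)"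
  define Q :: "'a mat" where "Q = four_block_mat (0\<^sub>m m n) (1\<^sub>m m) (1\<^sub>m n) (0\<^sub>m n m)"
  have PB: "P * four_block_mat B (0\<^sub>m m n) (0\<^sub>m n m) A = four_block_mat (0\<^sub>m n m) A B (0\<^sub>m m n)"
    unfolding P_def by (subst mult_four_block_mat[of _ n m _ n _ m _ _ m _ n]) (use assms in auto)
  show ?thesis
  proof (rule similar_matI[of _ _ P Q "n + m"])
    show "P * Q = 1\<^sub>m (n + m)"
      unfolding P_def Q_def by (subst mult_four_block_mat[of _ n m _ n _ m _ _ n _ m]) auto
    show "Q * P = 1\<^sub>m (n + m)"
      unfolding P_def Q_def
      by (subst mult_four_block_mat[of _ m n _ m _ n _ _ m _ n]) (auto simp: add.commute)
    show "four_block_mat A (0\<^sub>m n m) (0\<^sub>m m n) B = P * four_block_mat B (0\<^sub>m m n) (0\<^sub>m n m) A * Q"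
      unfolding PB unfolding Q_def
      by (subst mult_four_block_mat[of _ n m _ n _ m _ _ n _ m]) (use assms in auto)
    have "P \<in> carrier_mat (n + m) (n + m)" "Q \<in> carrier_mat (n + m) (n + m)"
      "four_block_mat B (0\<^sub>m m n) (0\<^sub>m n m) A \<in> carrier_mat (n + m) (n + m)"
      by (rule carrier_matI; use assms in \<open>simp add: P_def Q_def\<close>)+
    then show "{four_block_mat A (0\<^sub>m n m) (0\<^sub>m m n) B, four_block_mat B (0\<^sub>m m n) (0\<^sub>m n m) A, P, Q}
        \<subseteq> carrier_mat (n + m) (n + m)"
      using assms by simp
  qed
qed

lemma diag_block_mat_carrier:
  assumes "\<forall>X\<in>set Xs. square_mat X"
  obtains n where "diag_block_mat Xs \<in> carrier_mat n n"
  using diag_block_mat_square[of Xs] assms unfolding square_mat.simps by blast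

lemma similar_diag_block_mat_append_swap:
  assumes "\<forall>X\<in>set (Xs @ Ys). square_mat X"
  shows "similar_mat (diag_block_mat (Xs @ Ys)) (diag_block_mat (Ys @ Xs))"
proof -
  obtain n where "diag_block_mat Xs \<in> carrier_mat n n"
    using assms diag_block_mat_carrier[of Xs] unfolding set_append by blast
  moreover obtain m where "diag_block_mat Ys \<in> carrier_mat m m"
    using assms diag_block_mat_carrier[of Ys] unfolding set_append by blast
  ultimately show ?thesis
    using similar_four_block_swap by (auto simp: diag_block_mat_append Let_def)
qed

lemma similar_diag_block_mat_perm:
  assumes "mset Xs = mset Ys" and "\<forall>X\<in>set Xs. square_mat X"
  shows "similar_mat (diag_block_mat Xs) (diag_block_mat Ys)"
  using assms
proof (induction Xs arbitrary: Ys)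
  case Nil
  then show ?case using similar_mat_refl[of "0\<^sub>m 0 0" 0] by simp
next
  case (Cons X Xs)
  have "X \<in> set Ys"
    using Cons.prems(1) by (metis list.set_intros(1) set_mset_mset)
  then obtain Us Vs where Ys: "Ys = Us @ X # Vs" by (meson split_list)
  have m: "mset Xs = mset (Vs @ Us)" using Cons.prems(1) Ys by simp
  have sq: "square_mat X" "\<forall>X\<in>set Xs. square_mat X" using Cons.prems by auto
  have "set Xs = set (Vs @ Us)" using m by (metis set_mset_mset)
  have 1: "similar_mat (diag_block_mat Xs) (diag_block_mat (Vs @ Us))"
    using Cons.IH m sq by blast
  have X: "X \<in> carrier_mat (dim_row X) (dim_row X)"
    using sq(1) by (intro carrier_matI) simp_all
  obtain m where D: "diag_block_mat Xs \<in> carrier_mat m m" "diag_block_mat (Vs @ Us) \<in> carrier_mat m m"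
    using similar_matD[OF 1] by blast
  \<comment> \<open>The induction hypothesis rearranges the tail into \<open>Vs @ Us\<close>;
    exchanging the parts \<open>X # Vs\<close> and \<open>Us\<close> then moves \<open>X\<close> to
    its place in \<open>Ys\<close>.\<close>
  have "similar_mat (diag_block_mat (X # Xs)) (diag_block_mat ((X # Vs) @ Us))"
    using similar_mat_four_block_0_0[OF similar_mat_refl[OF X] 1 X D(1)] D sq(1) by (simp add: Let_def)
  also have "similar_mat (diag_block_mat ((X # Vs) @ Us)) (diag_block_mat Ys)"
    unfolding Ys by (rule similar_diag_block_mat_append_swap)
      (use sq \<open>set Xs = set (Vs @ Us)\<close> in auto)
  finally (similar_mat_trans) show ?case .
qed

lemma four_block_mat_eq_one:
  assumes "four_block_mat A B C D = 1\<^sub>m (n + m)"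
    and "A \<in> carrier_mat n n" "D \<in> carrier_mat m m"
  shows "A = 1\<^sub>m n" "D = 1\<^sub>m m"
proof -
  have e: "four_block_mat A B C D $$ (i, j) = 1\<^sub>m (n + m) $$ (i, j)" for i j using assms(1) by simp
  show "A = 1\<^sub>m n"
  proof (rule eq_matI)
    fix i j assume "i < dim_row (1\<^sub>m n :: 'a mat)" "j < dim_col (1\<^sub>m n :: 'a mat)"
    then show "A $$ (i, j) = 1\<^sub>m n $$ (i, j)" using e[of i j] assms(2,3) by simp
  qed (use assms(2) in auto)
  show "D = 1\<^sub>m m"
  proof (rule eq_matI)
    fix i j assume "i < dim_row (1\<^sub>m m :: 'a mat)" "j < dim_col (1\<^sub>m m :: 'a mat)"
    then show "D $$ (i, j) = 1\<^sub>m m $$ (i, j)" using e[of "n + i" "n + j"] assms(2,3) by simp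
  qed (use assms(3) in auto)
qed

text \<open>\<open>Q\<close> may have entries off the diagonal blocks, but the diagonal blocks of
  the product involve only the diagonal blocks of \<open>Q\<close>, and these are the right
  inverses. In this way invertibility descends from a matrix to its Jordan blocks.\<close>

lemma diag_block_mat_right_inverse:
  assumes "diag_block_mat Xs \<in> carrier_mat n n" "Q \<in> carrier_mat n n"
    and "diag_block_mat Xs * Q = 1\<^sub>m n"
    and "\<forall>X\<in>set Xs. square_mat X" and "X \<in> set Xs"
  shows "\<exists>Y\<in>carrier_mat (dim_row X) (dim_row X). X * Y = 1\<^sub>m (dim_row X)"
  using assms
proof (induction Xs arbitrary: Q n)
  case (Cons X' Xs)
  define D where "D = diag_block_mat Xs"
  define k where "k = dim_row X'"
  have X': "X' \<in> carrier_mat k k" using Cons.prems(4) unfolding k_def by (intro carrier_matI) simp_all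
  obtain m where D: "D \<in> carrier_mat m m"
    unfolding D_def using Cons.prems(4) diag_block_mat_carrier[of Xs] unfolding list.set by blast
  have n: "n = k + m" using Cons.prems(1) X' D by (auto simp: D_def Let_def)
  have eq: "four_block_mat X' (0\<^sub>m k m) (0\<^sub>m m k) D * Q = 1\<^sub>m (k + m)"
    using Cons.prems(3) X' D by (simp add: D_def Let_def n)
  obtain Q1 Q2 Q3 Q4 where "split_block Q k k = (Q1, Q2, Q3, Q4)" by (metis prod_cases4)
  note sp = split_block[OF this, of m m]
  have Qs: "Q1 \<in> carrier_mat k k" "Q2 \<in> carrier_mat k m" "Q3 \<in> carrier_mat m k"
    "Q4 \<in> carrier_mat m m" and Q: "Q = four_block_mat Q1 Q2 Q3 Q4"
    using sp Cons.prems(2) n by auto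
  have "four_block_mat (X' * Q1) (X' * Q2) (D * Q3) (D * Q4) = 1\<^sub>m (k + m)"
    using eq X' D Qs unfolding Q
    by (subst (asm) mult_four_block_mat[of _ k k _ m _ m _ _ k _ m]) auto
  from four_block_mat_eq_one[OF this] X' D Qs
  have 1: "X' * Q1 = 1\<^sub>m k" "D * Q4 = 1\<^sub>m m" by auto
  show ?case
  proof (cases "X = X'")
    case True
    then show ?thesis using 1(1) Qs(1) X' by auto
  next
    case False
    then show ?thesis using Cons.IH[of m Q4] Cons.prems D Qs 1(2) by (auto simp: D_def)
  qed
qed simp

text \<open>\<open>F\<close> acts on whole matrices and may change their size, so that both scalar
  embeddings and size-doubling maps such as \<open>complex_rep\<close> are covered.\<close>

lemma similar_mat_image:
  assumes "similar_mat A B" "A \<in> carrier_mat n n"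
    and "\<And>A. A \<in> carrier_mat n n \<Longrightarrow> F A \<in> carrier_mat m m" "F (1\<^sub>m n) = 1\<^sub>m m"
    and "\<And>A B. A \<in> carrier_mat n n \<Longrightarrow> B \<in> carrier_mat n n \<Longrightarrow> F (A * B) = F A * F B"
  shows "similar_mat (F A) (F B)"
proof -
  obtain P Q where w: "similar_mat_wit A B P Q" using assms(1) by (auto simp: similar_mat_def)
  note d = similar_mat_witD2[OF assms(2) w]
  show ?thesis
  proof (rule similar_matI[of _ _ "F P" "F Q" m])
    show "F P * F Q = 1\<^sub>m m" "F Q * F P = 1\<^sub>m m" using d assms by metis+
    have "F A = F (P * B * Q)" using d(3) by simp
    also have "\<dots> = F P * F B * F Q" using d(4-7) assms(3,5) by (simp add: assoc_mult_mat[of _ m m _ m _ m])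
    finally show "F A = F P * F B * F Q" .
  qed (use assms(3) d(4-7) in auto)
qed

lemma inverse_similar_image:
  assumes "inverse_similar X Y" "X \<in> carrier_mat n n"
    and "\<And>A. A \<in> carrier_mat n n \<Longrightarrow> F A \<in> carrier_mat m m" "F (1\<^sub>m n) = 1\<^sub>m m"
    and "\<And>A B. A \<in> carrier_mat n n \<Longrightarrow> B \<in> carrier_mat n n \<Longrightarrow> F (A * B) = F A * F B"
  shows "inverse_similar (F X) (F Y)"
proof -
  obtain Z where Z: "Z \<in> carrier_mat n n" "X * Z = 1\<^sub>m n" "Z * X = 1\<^sub>m n" "similar_mat Z Y"
    using assms(1,2) by (metis inverse_similarE carrier_matD(1))
  show ?thesis
    by (rule inverse_similarI[of _ m "F Z"])
      (use Z assms(2-5) similar_mat_image[OF Z(4,1) assms(3-5)] in \<open>metis+\<close>)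
qed

lemma reversible_GL_iff:
  assumes "A \<in> carrier (GL n)"
  shows "reversible (GL n) A \<longleftrightarrow> inverse_similar A A"
proof -
  let ?R = "ring_mat TYPE('a) n ()"
  interpret semiring ?R by (rule semiring_mat)
  note [simp] = assoc_mult_mat[of _ n n _ n _ n]
  have A: "A \<in> Units ?R" using assms by (simp add: GL_def units_of_def)
  define B where "B = inv\<^bsub>GL n\<^esub> A"
  have inv: "inv\<^bsub>GL n\<^esub> h \<in> carrier_mat n n \<and> h * inv\<^bsub>GL n\<^esub> h = 1\<^sub>m n \<and> inv\<^bsub>GL n\<^esub> h * h = 1\<^sub>m n"
    if "h \<in> Units ?R" for h
    using that Units_inv_closed[OF that] Units_r_inv[OF that] Units_l_inv[OF that]
    by (simp add: GL_def units_of_inv ring_mat_simps)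
  have A': "A \<in> carrier_mat n n" using A by (auto simp: Units_def ring_mat_simps)
  have B: "B \<in> carrier_mat n n" "A * B = 1\<^sub>m n" "B * A = 1\<^sub>m n"
    using inv[OF A] unfolding B_def by auto
  have "reversible (GL n) A \<longleftrightarrow> (\<exists>h\<in>Units ?R. h * A * inv\<^bsub>GL n\<^esub> h = B)"
    by (simp add: reversible_def B_def) (simp add: GL_def units_of_def ring_mat_simps)
  also have "\<dots> \<longleftrightarrow> similar_mat B A"
  proof
    assume "\<exists>h\<in>Units ?R. h * A * inv\<^bsub>GL n\<^esub> h = B"
    then obtain h where h: "h \<in> Units ?R" "h * A * inv\<^bsub>GL n\<^esub> h = B" by blast
    have "h \<in> carrier_mat n n" using h(1) by (auto simp: Units_def ring_mat_simps)
    then show "similar_mat B A"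
      using inv[OF h(1)] A' B h(2) by (intro similar_matI[of _ _ h "inv\<^bsub>GL n\<^esub> h" n]) auto
  next
    assume "similar_mat B A"
    then obtain P Q where "similar_mat_wit B A P Q" by (auto simp: similar_mat_def)
    note d = similar_mat_witD2[OF B(1) this]
    have P: "P \<in> Units ?R" using d by (auto simp: Units_def ring_mat_simps)
    note i = inv[OF P]
    \<comment> \<open>The right factor of a similarity witness is forced to be the group inverse of
      the left one.\<close>
    have "Q = Q * (P * inv\<^bsub>GL n\<^esub> P)" using i d by simp
    also have "\<dots> = (Q * P) * inv\<^bsub>GL n\<^esub> P" using i d(4-7) by simp
    also have "\<dots> = inv\<^bsub>GL n\<^esub> P" using d i by auto
    finally show "\<exists>h\<in>Units ?R. h * A * inv\<^bsub>GL n\<^esub> h = B" using P d(3) by metis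
  qed
  also have "\<dots> \<longleftrightarrow> inverse_similar A A"
  proof
    assume "similar_mat B A"
    then show "inverse_similar A A" using A' B by (intro inverse_similarI)
  next
    assume "inverse_similar A A"
    moreover have "inverse_similar A B"
      using similar_mat_refl[OF B(1)] A' B by (intro inverse_similarI)
    ultimately show "similar_mat B A" by (rule inverse_similar_unique[rotated])
  qed
  finally show ?thesis .
qed

section \<open>Pairing the entries of a list\<close>

text \<open>The \<open>r\<close>-th occurrence of \<open>x\<close> will be paired with the \<open>r\<close>-th occurrence of \<open>\<sigma> x\<close>; this makes the
  pairing an involution without choosing a representative of \<open>{x, \<sigma> x}\<close>.\<close>

definition occurrence :: "'a list \<Rightarrow> nat \<Rightarrow> 'a \<times> nat"
  where "occurrence xs i = (xs ! i, count (mset (take i xs)) (xs ! i))"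

lemma inj_on_occurrence: "inj_on (occurrence xs) {..<length xs}"
proof -
  have "occurrence xs i \<noteq> occurrence xs j" if "i < j" "j < length xs" for i j
  proof
    assume e: "occurrence xs i = occurrence xs j"
    have "take (Suc i) xs = take i xs @ [xs ! i]"
      using that by (simp add: take_Suc_conv_app_nth)
    moreover have "mset (take (Suc i) xs) \<subseteq># mset (take j xs)"
      by (metis Suc_leI that(1) append_take_drop_id min.absorb1 mset_append mset_subset_eq_add_left
          take_take)
    then have "count (mset (take (Suc i) xs)) (xs ! i) \<le> count (mset (take j xs)) (xs ! i)"
      by (simp add: subseteq_mset_def)
    ultimately have "count (mset (take i xs)) (xs ! i) < count (mset (take j xs)) (xs ! i)" by simp
    then show False using e by (auto simp: occurrence_def)
  qed
  then show ?thesis by (auto simp: inj_on_def) (metis nat_neq_iff)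
qed

text \<open>Together with injectivity this identifies positions with the copies of elements: a
  position exists for every element and every rank below its multiplicity.\<close>

lemma occurrence_image:
  "occurrence xs ` {..<length xs} = {(x, r). r < count (mset xs) x}"
proof (induction xs rule: rev_induct)
  case (snoc y ys)
  have "occurrence (ys @ [y]) ` {..<length (ys @ [y])}
      = insert (occurrence (ys @ [y]) (length ys)) (occurrence (ys @ [y]) ` {..<length ys})"
    by (simp add: lessThan_Suc)
  also have "occurrence (ys @ [y]) ` {..<length ys} = occurrence ys ` {..<length ys}"
    by (auto simp: occurrence_def nth_append)
  also have "occurrence (ys @ [y]) (length ys) = (y, count (mset ys) y)"
    by (simp add: occurrence_def)
  finally show ?case unfolding snoc by (auto simp: less_Suc_eq split: if_splits)
qed simp

text \<open>Invariance of the multiset gives \<open>x\<close> and \<open>\<sigma> x\<close> the same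
  multiplicity, so a rank valid for one is valid for the other. The last conclusion keeps equal
  copies of a fixed label from being paired with each other: they have to become singletons, since
  the pair patterns exclude such labels.\<close>

lemma ex_involution_positions:
  assumes inv: "\<And>x. x \<in> set xs \<Longrightarrow> \<sigma> (\<sigma> x) = x" and m: "mset (map \<sigma> xs) = mset xs"
  obtains \<tau> where "\<And>i. i < length xs \<Longrightarrow> \<tau> i < length xs"
    "\<And>i. i < length xs \<Longrightarrow> \<tau> (\<tau> i) = i"
    "\<And>i. i < length xs \<Longrightarrow> xs ! \<tau> i = \<sigma> (xs ! i)"
    "\<And>i. i < length xs \<Longrightarrow> \<sigma> (xs ! i) = xs ! i \<Longrightarrow> \<tau> i = i"
proof -
  let ?N = "{..<length xs}"
  let ?K = "{(x, r). r < count (mset xs) x}"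
  define g where "g = inv_into ?N (occurrence xs)"
  define f where "f = (\<lambda>i. (\<sigma> (xs ! i), snd (occurrence xs i)))"
  define \<tau> where "\<tau> = g \<circ> f"
  have \<sigma>s: "\<sigma> x \<in> set xs" if "x \<in> set xs" for x
    using that m by (metis image_eqI list.set_map set_mset_mset)
  have inj: "inj_on \<sigma> (set xs)" using inv by (metis inj_onI)
  have cnt: "count (mset xs) (\<sigma> x) = count (mset xs) x" if "x \<in> set xs" for x
  proof -
    have "count (mset xs) (\<sigma> x) = count (image_mset \<sigma> (mset xs)) (\<sigma> x)" using m by simp
    also have "\<dots> = count (mset xs) x"
    proof -
      have "\<sigma> -` {\<sigma> x} \<inter> set_mset (mset xs) = {x}" using inj that by (auto dest: inj_onD)
      then show ?thesis by (simp add: count_image_mset)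
    qed
    finally show ?thesis .
  qed
  have g: "g k \<in> ?N \<and> occurrence xs (g k) = k" if "k \<in> ?K" for k
    using that inv_into_into[of k "occurrence xs" ?N] f_inv_into_f[of k "occurrence xs" ?N]
    unfolding occurrence_image g_def by blast
  have g': "g (occurrence xs i) = i" if "i < length xs" for i
    using that by (simp add: g_def inv_into_f_f[OF inj_on_occurrence])
  have f: "f i \<in> ?K" if "i < length xs" for i
  proof -
    have "occurrence xs i \<in> ?K" using that unfolding occurrence_image[symmetric] by simp
    then have "snd (occurrence xs i) < count (mset xs) (xs ! i)" by (simp add: occurrence_def)
    then show ?thesis using cnt[of "xs ! i"] that unfolding f_def by simp
  qed
  have \<tau>: "\<tau> i < length xs" "occurrence xs (\<tau> i) = f i" if "i < length xs" for i
    using g[OF f[OF that]] by (auto simp: \<tau>_def)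
  have nth: "xs ! \<tau> i = \<sigma> (xs ! i)" if "i < length xs" for i
    using arg_cong[OF \<tau>(2)[OF that], of fst] by (simp add: f_def occurrence_def)
  show thesis
  proof
    fix i assume i: "i < length xs"
    show "\<tau> i < length xs" "xs ! \<tau> i = \<sigma> (xs ! i)" by (fact \<tau>(1)[OF i] nth[OF i])+
    have "f (\<tau> i) = occurrence xs i"
      using arg_cong[OF \<tau>(2)[OF i], of snd] nth[OF i] inv i by (simp add: f_def occurrence_def)
    then show "\<tau> (\<tau> i) = i" using g'[OF i] by (simp add: \<tau>_def)
    assume "\<sigma> (xs ! i) = xs ! i"
    then have "f i = occurrence xs i" by (simp add: f_def occurrence_def)
    then show "\<tau> i = i" using g'[OF i] by (simp add: \<tau>_def)
  qed
qed

text \<open>The cells are the orbits of \<open>\<tau>\<close>. Since \<open>pair\<close> is supplied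
  at \<open>i\<close> and at \<open>\<tau> i\<close>, each orbit may be listed in either
  order.\<close>

lemma pairs_and_singletonsI:
  assumes "\<And>i. i < length Bs \<Longrightarrow> \<tau> i < length Bs" "\<And>i. i < length Bs \<Longrightarrow> \<tau> (\<tau> i) = i"
    and "\<And>i. i < length Bs \<Longrightarrow> \<tau> i \<noteq> i \<Longrightarrow> pair (Bs ! i) (Bs ! \<tau> i)"
    and "\<And>i. i < length Bs \<Longrightarrow> \<tau> i = i \<Longrightarrow> single (Bs ! i)"
  shows "pairs_and_singletons pair single Bs"
  unfolding pairs_and_singletons_def
proof (intro exI conjI ballI)
  let ?P = "(\<lambda>i. {i, \<tau> i}) ` {..<length Bs}"
  show "partition_on {..<length Bs} ?P"
  proof (rule partition_onI)
    show "\<Union> ?P = {..<length Bs}" using assms(1) by auto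
    show "disjnt p q" if "p \<in> ?P" "q \<in> ?P" "p \<noteq> q" for p q
      using that assms(1,2) unfolding disjnt_def by (auto, metis+)
  qed auto
  fix p assume "p \<in> ?P"
  then obtain i where i: "i < length Bs" "p = {i, \<tau> i}" by auto
  show "(\<exists>i j. p = {i, j} \<and> i \<noteq> j \<and> pair (Bs ! i) (Bs ! j)) \<or> (\<exists>i. p = {i} \<and> single (Bs ! i))"
  proof (cases "\<tau> i = i")
    case True
    then show ?thesis using assms(4)[OF i(1)] i(2) by auto
  next
    case False
    then show ?thesis using assms(3)[OF i(1)] i(2) by metis
  qed
qed

text \<open>Sending each position to its partner in the cell, or to itself in a singleton, is an
  involution and hence a permutation; \<open>Cs\<close> is \<open>Bs\<close> rearranged by
  it.\<close>

lemma pairs_and_singletonsE: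
  assumes "pairs_and_singletons pair single Bs"
    and "\<And>X Y. X \<in> set Bs \<Longrightarrow> Y \<in> set Bs \<Longrightarrow> pair X Y \<Longrightarrow> R X Y"
    and "\<And>X Y. X \<in> set Bs \<Longrightarrow> Y \<in> set Bs \<Longrightarrow> pair X Y \<Longrightarrow> R Y X"
    and "\<And>X. X \<in> set Bs \<Longrightarrow> single X \<Longrightarrow> R X X"
  obtains Cs where "mset Cs = mset Bs" "list_all2 R Bs Cs"
proof -
  let ?N = "{..<length Bs}"
  obtain P where P: "partition_on ?N P"
    and blocks: "\<forall>p\<in>P. (\<exists>i j. p = {i, j} \<and> i \<noteq> j \<and> pair (Bs ! i) (Bs ! j)) \<or>
              (\<exists>i. p = {i} \<and> single (Bs ! i))"
    using assms(1) unfolding pairs_and_singletons_def by (elim exE conjE)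
  have ex: "\<exists>j. {i, j} \<in> P \<and> R (Bs ! i) (Bs ! j)" if i: "i \<in> ?N" for i
  proof -
    obtain p where p: "p \<in> P" "i \<in> p" using P i unfolding partition_on_def by auto
    have "p \<subseteq> ?N" using P p(1) by (auto simp: partition_on_def)
    then have mem: "k \<in> p \<Longrightarrow> Bs ! k \<in> set Bs" for k by auto
    from bspec[OF blocks p(1)] consider a b where "p = {a, b}" "pair (Bs ! a) (Bs ! b)"
      | a where "p = {a}" "single (Bs ! a)" by blast
    then show ?thesis
    proof cases
      case (1 a b)
      then have "i = a \<or> i = b" using p by auto
      then show ?thesis using 1 p(1) assms(2,3) mem by (metis doubleton_eq_iff insertCI)
    next
      case (2 a)
      then show ?thesis using p assms(4) mem by (intro exI[of _ i]) auto
    qed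
  qed
  then obtain \<tau> where \<tau>: "\<And>i. i \<in> ?N \<Longrightarrow> {i, \<tau> i} \<in> P" "\<And>i. i \<in> ?N \<Longrightarrow> R (Bs ! i) (Bs ! \<tau> i)"
    by metis
  have \<tau>N: "\<tau> i \<in> ?N" if "i \<in> ?N" for i using \<tau>(1)[OF that] P by (auto simp: partition_on_def)
  have \<tau>\<tau>: "\<tau> (\<tau> i) = i" if "i \<in> ?N" for i
  proof -
    have "{i, \<tau> i} \<in> P" "{\<tau> i, \<tau> (\<tau> i)} \<in> P" using \<tau>(1) \<tau>N that by auto
    \<comment> \<open>Both cells contain \<open>\<tau> i\<close>, and distinct cells are
      disjoint.\<close>
    then have "{i, \<tau> i} = {\<tau> i, \<tau> (\<tau> i)}"
      using disjointD[of P "{i, \<tau> i}" "{\<tau> i, \<tau> (\<tau> i)}"] partition_onD2[OF P] by blast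
    then show ?thesis by (metis doubleton_eq_iff)
  qed
  have bij: "bij_betw \<tau> ?N ?N"
    by (rule bij_betw_byWitness[of _ \<tau>]) (use \<tau>N \<tau>\<tau> in auto)
  show thesis
  proof
    let ?Cs = "map (\<lambda>i. Bs ! \<tau> i) [0..<length Bs]"
    have "mset ?Cs = image_mset (\<lambda>i. Bs ! i) (image_mset \<tau> (mset_set ?N))"
      by (simp add: multiset.map_comp comp_def atLeast0LessThan)
    also have "image_mset \<tau> (mset_set ?N) = mset_set ?N"
      using bij by (simp add: image_mset_mset_set bij_betw_def)
    also have "image_mset (\<lambda>i. Bs ! i) (mset_set ?N) = mset Bs"
      by (metis atLeast0LessThan map_nth mset_map mset_upt)
    finally show "mset ?Cs = mset Bs" .
    show "list_all2 R Bs ?Cs" using \<tau>(2) by (auto simp: list_all2_conv_all_nth)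
  qed
qed

text \<open>\<open>L\<close> is the set of labels of all admissible blocks \<open>B l\<close>, \<open>I\<close> contains the labels of the
  invertible ones, and \<open>\<sigma>\<close> maps the label of a block to that of its inverse.\<close>

lemma reversible_iff_pairs_and_singletons:
  fixes B :: "'l \<Rightarrow> 'a::semiring_1 mat"
  assumes A: "A \<in> carrier (GL n)" "jordan_form (B ` L) A Bs"
    and square: "\<And>l. l \<in> L \<Longrightarrow> square_mat (B l)"
    and uniq: "\<And>ls ls'. set ls \<subseteq> L \<Longrightarrow> set ls' \<subseteq> L \<Longrightarrow>
      similar_mat (diag_block_mat (map B ls)) (diag_block_mat (map B ls')) \<Longrightarrow> mset ls = mset ls'"
    and \<sigma>: "\<And>l. l \<in> L \<Longrightarrow> \<sigma> l \<in> L" "\<And>l. l \<in> L \<Longrightarrow> \<sigma> (\<sigma> l) = l"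
    and inv: "\<And>l Y. l \<in> L \<Longrightarrow> Y \<in> carrier_mat (dim_row (B l)) (dim_row (B l)) \<Longrightarrow>
      B l * Y = 1\<^sub>m (dim_row (B l)) \<Longrightarrow> l \<in> I"
    and \<sigma>B: "\<And>l. l \<in> L \<inter> I \<Longrightarrow> inverse_similar (B l) (B (\<sigma> l))"
    and pairI: "\<And>l. l \<in> L \<inter> I \<Longrightarrow> \<sigma> l \<noteq> l \<Longrightarrow> pair (B l) (B (\<sigma> l))"
    and singleI: "\<And>l. l \<in> L \<inter> I \<Longrightarrow> \<sigma> l = l \<Longrightarrow> single (B l)"
    and pairD: "\<And>X Y. pair X Y \<Longrightarrow> inverse_similar X Y"
    and singleD: "\<And>X. single X \<Longrightarrow> inverse_similar X X"
  shows "reversible (GL n) A \<longleftrightarrow> pairs_and_singletons pair single Bs"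
proof -
  have sim: "similar_mat A (diag_block_mat Bs)" and sub: "set Bs \<subseteq> B ` L"
    using A(2) by (auto simp: jordan_form_def)
  obtain ls where ls: "set ls \<subseteq> L" "Bs = map B ls"
  proof -
    obtain f where "\<forall>X\<in>set Bs. f X \<in> L \<and> B (f X) = X" using sub by (metis f_inv_into_f inv_into_into subsetD)
    then show thesis by (intro that[of "map f Bs"]) (auto simp: map_idI comp_def)
  qed
  have sq: "\<forall>X\<in>set Bs. square_mat X" using ls square by auto
  have rev: "reversible (GL n) A \<longleftrightarrow> inverse_similar (diag_block_mat Bs) (diag_block_mat Bs)"
    unfolding reversible_GL_iff[OF A(1)]
    using sim similar_mat_sym inverse_similar_trans inverse_similar_trans_left by blast
  \<comment> \<open>Invertibility passes from \<open>A\<close> to the similar block diagonal matrix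
    and from there to each block, whose label then lies in \<open>I\<close>.\<close>
  have lsI: "set ls \<subseteq> L \<inter> I"
  proof
    fix l assume l: "l \<in> set ls"
    obtain C where C: "A \<in> carrier_mat n n" "C \<in> carrier_mat n n" "A * C = 1\<^sub>m n" "C * A = 1\<^sub>m n"
      using A(1) by (auto simp: GL_def units_of_def Units_def ring_mat_simps)
    then have "inverse_similar A C" using similar_mat_refl[OF C(2)] by (intro inverse_similarI)
    then have "inverse_similar (diag_block_mat Bs) C" using sim inverse_similar_trans_left by blast
    then obtain m Q where "diag_block_mat Bs \<in> carrier_mat m m" "Q \<in> carrier_mat m m"
      "diag_block_mat Bs * Q = 1\<^sub>m m"
      by (rule inverse_similarE)
    from diag_block_mat_right_inverse[OF this sq, of "B l"] show "l \<in> L \<inter> I"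
      using inv[of l] l ls by auto
  qed
  show ?thesis
    unfolding rev
  proof
    assume "inverse_similar (diag_block_mat Bs) (diag_block_mat Bs)"
    \<comment> \<open>A second description of the inverse, block by block, to be compared with the
      one given by reversibility.\<close>
    moreover have "inverse_similar (diag_block_mat Bs) (diag_block_mat (map B (map \<sigma> ls)))"
      unfolding ls(2)
    proof (rule inverse_similar_diag_block_mat)
      show "list_all2 inverse_similar (map B ls) (map B (map \<sigma> ls))"
        unfolding list_all2_map1 list_all2_map2 by (rule list.rel_refl_strong) (use lsI \<sigma>B in blast)
    qed
    ultimately have "similar_mat (diag_block_mat (map B (map \<sigma> ls))) (diag_block_mat (map B ls))"
      unfolding ls(2) by (rule inverse_similar_unique[rotated])
    then have "mset (map \<sigma> ls) = mset ls" using \<sigma>(1) ls(1) by (intro uniq) auto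
    then obtain \<tau> where \<tau>: "\<And>i. i < length ls \<Longrightarrow> \<tau> i < length ls"
      "\<And>i. i < length ls \<Longrightarrow> \<tau> (\<tau> i) = i"
      "\<And>i. i < length ls \<Longrightarrow> ls ! \<tau> i = \<sigma> (ls ! i)"
      "\<And>i. i < length ls \<Longrightarrow> \<sigma> (ls ! i) = ls ! i \<Longrightarrow> \<tau> i = i"
      using ex_involution_positions[of ls \<sigma>] \<sigma>(2) ls(1) by blast
    show "pairs_and_singletons pair single Bs"
    proof (rule pairs_and_singletonsI[of _ \<tau>])
      fix i assume "i < length Bs"
      then have i: "i < length ls" "ls ! i \<in> L \<inter> I" using ls lsI by auto
      show "\<tau> i < length Bs" "\<tau> (\<tau> i) = i" using \<tau> i ls by auto
      show "pair (Bs ! i) (Bs ! \<tau> i)" if "\<tau> i \<noteq> i"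
        using pairI[OF i(2)] \<tau>[OF i(1)] i that by (auto simp: ls(2))
      show "single (Bs ! i)" if "\<tau> i = i"
        using singleI[OF i(2)] \<tau>(3)[OF i(1)] i that by (auto simp: ls(2))
    qed
  next
    assume "pairs_and_singletons pair single Bs"
    \<comment> \<open>Inverting every block separately replaces it by its partner, so the inverse is
      similar to the same blocks in another order.\<close>
    then obtain Cs where Cs: "mset Cs = mset Bs" "list_all2 inverse_similar Bs Cs"
      by (rule pairs_and_singletonsE[where R = inverse_similar])
        (use pairD singleD inverse_similar_sym in blast)+
    have "similar_mat (diag_block_mat Cs) (diag_block_mat Bs)"
      using Cs(1) sq by (intro similar_diag_block_mat_perm) (auto dest: mset_eq_setD)
    then show "inverse_similar (diag_block_mat Bs) (diag_block_mat Bs)"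
      using inverse_similar_diag_block_mat[OF Cs(2)] inverse_similar_trans by blast
  qed
qed

section \<open>Jordan blocks over fields and quaternions\<close>

text \<open>The diagonal entries need not commute with those of \<open>A\<close>. The lemma is
  applied to the constant diagonal \<open>j\<close> over the quaternions and to alternating signs
  over the reals.\<close>

lemma similar_mat_diagonal_conj:
  fixes A :: "'a::semiring_1 mat"
  assumes A: "A \<in> carrier_mat n n"
    and fg: "\<And>i. i < n \<Longrightarrow> f i * g i = 1" "\<And>i. i < n \<Longrightarrow> g i * f i = 1"
  shows "similar_mat (mat n n (\<lambda>(i, j). f i * A $$ (i, j) * g j)) A"
proof (rule similar_matI[of _ _ "mat n n (\<lambda>(i, j). if i = j then f i else 0)"
      "mat n n (\<lambda>(i, j). if i = j then g i else 0)" n])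
  have left: "mat n n (\<lambda>(i, j). if i = j then h i else 0) * M
      = mat n n (\<lambda>(i, j). h i * M $$ (i, j))"
    if "M \<in> carrier_mat n n" for h :: "nat \<Rightarrow> 'a" and M
    using that
    by (intro eq_matI) (auto simp: scalar_prod_def if_distrib[of "\<lambda>x. x * _"] cong: if_cong)
  have right: "M * mat n n (\<lambda>(i, j). if i = j then h i else 0)
      = mat n n (\<lambda>(i, j). M $$ (i, j) * h j)"
    if "M \<in> carrier_mat n n" for h :: "nat \<Rightarrow> 'a" and M
    using that
    by (intro eq_matI) (auto simp: scalar_prod_def if_distrib[of "\<lambda>x. _ * x"] cong: if_cong)
  show "mat n n (\<lambda>(i, j). f i * A $$ (i, j) * g j) = mat n n (\<lambda>(i, j). if i = j then f i else 0) * A *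
      mat n n (\<lambda>(i, j). if i = j then g i else 0)"
    using A by (subst right) (auto simp: left intro!: eq_matI)
  show "mat n n (\<lambda>(i, j). if i = j then f i else 0) * mat n n (\<lambda>(i, j). if i = j then g i else 0) = 1\<^sub>m n"
    by (subst left) (auto simp: fg intro!: eq_matI)
  show "mat n n (\<lambda>(i, j). if i = j then g i else 0) * mat n n (\<lambda>(i, j). if i = j then f i else 0) = 1\<^sub>m n"
    by (subst left) (auto simp: fg intro!: eq_matI)
qed (use A in auto)

lemma jordan_block_mult_left:
  fixes P :: "'a::semiring_1 mat"
  assumes "P \<in> carrier_mat m k" "i < m" "j < k"
  shows "(jordan_block m a * P) $$ (i, j) =
    a * P $$ (i, j) + (if Suc i < m then P $$ (Suc i, j) else 0)"
proof -
  have "(jordan_block m a * P) $$ (i, j) =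
      (\<Sum>l = 0..<m. (if i = l then a else if Suc i = l then 1 else 0) * P $$ (l, j))"
    using assms by (simp add: scalar_prod_def jordan_block_def)
  also have "\<dots> = (\<Sum>l = 0..<m. (if i = l then a * P $$ (l, j) else 0) +
      (if Suc i = l then P $$ (l, j) else 0))"
    by (rule sum.cong) auto
  finally show ?thesis using assms by (simp add: sum.distrib)
qed

lemma jordan_block_mult_right:
  fixes P :: "'a::semiring_1 mat"
  assumes "P \<in> carrier_mat k m" "i < k" "j < m"
  shows "(P * jordan_block m a) $$ (i, j) =
    P $$ (i, j) * a + (if j = 0 then 0 else P $$ (i, j - 1))"
proof -
  have "(P * jordan_block m a) $$ (i, j) =
      (\<Sum>l = 0..<m. P $$ (i, l) * (if l = j then a else if Suc l = j then 1 else 0))"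
    using assms by (simp add: scalar_prod_def jordan_block_def)
  \<comment> \<open>The condition \<open>Suc l = j\<close> has no solution for \<open>j = 0\<close>,
    while the truncated \<open>j - 1\<close> is then \<open>0\<close>; the inner conditional removes
    that false hit.\<close>
  also have "\<dots> = (\<Sum>l = 0..<m. (if l = j then P $$ (i, l) * a else 0) +
      (if l = j - 1 then if j = 0 then 0 else P $$ (i, l) else 0))"
    by (rule sum.cong) auto
  finally show ?thesis using assms less_imp_diff_less[OF assms(3), of 1] by (simp add: sum.distrib)
qed

text \<open>The last row of a nilpotent block is zero, so the last diagonal entry of the product is
  \<open>0\<close> and not \<open>1\<close>.\<close>

lemma jordan_block_0_not_right_invertible:
  assumes "Y \<in> carrier_mat m m" "jordan_block m (0 :: 'a::semiring_1) * Y = 1\<^sub>m m" "m > 0"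
  shows False
  using jordan_block_mult_left[OF assms(1), of "m - 1" "m - 1" 0] assms by simp

text \<open>The recursion is the entrywise form of \<open>J(a) P J(a\<^sup>-\<^sup>1) = P\<close>, solved for an upper triangular
  \<open>P\<close> whose first row is the first unit vector.\<close>

fun jordan_inverse_conj :: "'a::comm_ring_1 \<Rightarrow> nat \<Rightarrow> nat \<Rightarrow> 'a" where
  "jordan_inverse_conj a 0 0 = 1"
| "jordan_inverse_conj a (Suc i) 0 = 0"
| "jordan_inverse_conj a 0 (Suc j) = 0"
| "jordan_inverse_conj a (Suc i) (Suc j) =
    - a * (a * jordan_inverse_conj a i j + jordan_inverse_conj a (Suc i) j)"

lemma jordan_inverse_conj_lower: "j < i \<Longrightarrow> jordan_inverse_conj a i j = 0"
  by (induction a i j rule: jordan_inverse_conj.induct) auto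

lemma jordan_inverse_conj_diag: "jordan_inverse_conj a i i = (- a\<^sup>2) ^ i"
  by (induction i) (auto simp: jordan_inverse_conj_lower power2_eq_square)

text \<open>Once \<open>P\<close> is invertible, \<open>J(a) P J(1/a) = P\<close> says that
  \<open>P J(1/a) P^-1\<close> is a right inverse of \<open>J(a)\<close>; over a field it is then
  two-sided.\<close>

lemma inverse_similar_jordan_block:
  fixes a :: "'a::field"
  assumes "a \<noteq> 0"
  shows "inverse_similar (jordan_block m a) (jordan_block m (inverse a))"
proof -
  define P where "P = mat m m (\<lambda>(i, j). jordan_inverse_conj a i j)"
  have P: "P \<in> carrier_mat m m" by (simp add: P_def)
  \<comment> \<open>The determinant is the product of the diagonal entries, which are powers of
    \<open>- a\<^sup>2\<close> and thus nonzero.\<close>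
  have "upper_triangular P" by (auto simp: P_def jordan_inverse_conj_lower)
  then have "det P = prod_list (diag_mat P)" using P by (rule det_upper_triangular)
  also have "\<dots> \<noteq> 0"
    using assms by (auto simp: prod_list_zero_iff diag_mat_def P_def jordan_inverse_conj_diag)
  finally have "P \<in> Units (ring_mat TYPE('a) m ())" by (rule det_non_zero_imp_unit[OF P])
  then obtain Q where Q: "Q \<in> carrier_mat m m" "P * Q = 1\<^sub>m m" "Q * P = 1\<^sub>m m"
    by (auto simp: Units_def ring_mat_simps)
  \<comment> \<open>In the last row \<open>Suc i = m\<close> lies outside the matrix; there the
    recursion gives \<open>0\<close> because \<open>j < m\<close>, so one formula covers all
    rows.\<close>
  have JP: "(jordan_block m a * P) $$ (i, j) =
      a * jordan_inverse_conj a i j + jordan_inverse_conj a (Suc i) j"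
    if "i < m" "j < m" for i j
    using that by (subst jordan_block_mult_left[OF P]) (auto simp: P_def jordan_inverse_conj_lower)
  have eq: "jordan_block m a * P * jordan_block m (inverse a) = P"
  proof (rule eq_matI)
    fix i j assume "i < dim_row P" "j < dim_col P"
    then have ij: "i < m" "j < m" using P by auto
    have "(jordan_block m a * P * jordan_block m (inverse a)) $$ (i, j) =
        (jordan_block m a * P) $$ (i, j) * inverse a +
        (if j = 0 then 0 else (jordan_block m a * P) $$ (i, j - 1))"
      using ij P by (intro jordan_block_mult_right[of _ m]) auto
    also have "\<dots> = jordan_inverse_conj a i j"
      using ij assms by (cases j) (auto simp: JP field_simps)
    finally show "(jordan_block m a * P * jordan_block m (inverse a)) $$ (i, j) = P $$ (i, j)"
      using ij by (simp add: P_def)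
  qed (use P in auto)
  have J: "jordan_block m a \<in> carrier_mat m m" "jordan_block m (inverse a) \<in> carrier_mat m m"
    by auto
  define Z where "Z = P * jordan_block m (inverse a) * Q"
  have Z: "Z \<in> carrier_mat m m" unfolding Z_def by (intro mult_carrier_mat[OF mult_carrier_mat[OF P J(2)] Q(1)])
  have "jordan_block m a * Z = jordan_block m a * P * jordan_block m (inverse a) * Q"
    unfolding Z_def using P Q(1) J by (simp add: assoc_mult_mat[of _ m m _ m _ m])
  also have "\<dots> = 1\<^sub>m m" unfolding eq by (rule Q(2))
  finally have JZ: "jordan_block m a * Z = 1\<^sub>m m" .
  show ?thesis
  proof (rule inverse_similarI[OF J(1) Z JZ])
    show "Z * jordan_block m a = 1\<^sub>m m" by (rule mat_mult_left_right_inverse[OF J(1) Z JZ])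
    show "similar_mat Z (jordan_block m (inverse a))"
      by (rule similar_matI[of _ _ P Q m]) (use P Q J Z in \<open>simp_all add: Z_def\<close>)
  qed
qed

text \<open>Both lists are Jordan forms of the same matrix, and for each size \<open>k > 0\<close>
  and eigenvalue \<open>z\<close> the number of blocks is computed from that matrix alone. Blocks of
  size \<open>0\<close> leave no trace in it and are excluded.\<close>

lemma jordan_matrix_unique:
  fixes ls ls' :: "(nat \<times> 'a::field) list"
  assumes "similar_mat (jordan_matrix ls) (jordan_matrix ls')"
    and "0 \<notin> fst ` set ls" "0 \<notin> fst ` set ls'"
  shows "mset ls = mset ls'"
proof (rule multiset_eqI)
  fix l :: "nat \<times> 'a"
  obtain k z where l: "l = (k, z)" by force
  have jnf: "jordan_nf (jordan_matrix ls) ls" "jordan_nf (jordan_matrix ls) ls'"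
    using assms similar_mat_refl[OF jordan_matrix_carrier] by (auto simp: jordan_nf_def)
  show "count (mset ls) l = count (mset ls') l"
  proof (cases "k = 0")
    case True
    then have "l \<notin> set ls" "l \<notin> set ls'" using l assms(2,3) by force+
    then show ?thesis by (simp add: count_eq_zero_iff[THEN iffD2])
  next
    case False
    show ?thesis
      using compute_nr_of_jordan_blocks[OF jnf(1) False, of z]
        compute_nr_of_jordan_blocks[OF jnf(2) False, of z]
      by (simp add: count_mset count_list_eq_length_filter l)
  qed
qed

section \<open>Labels and their closure under conjugation\<close>

definition jordan_labels :: "(nat \<times> complex) set"
  where "jordan_labels = {(m, z). m > 0 \<and> Im z \<ge> 0}"

text \<open>Above the real axis the conjugated copies contribute nothing, so multiplicities agree
  directly. On the real axis each label is counted twice on both sides, and the factor 2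
  cancels.\<close>

lemma mset_eq_if_conjugate_closure_eq:
  assumes "mset (ls @ map (apsnd cnj) ls) = mset (ls' @ map (apsnd cnj) ls')"
    and "set ls \<subseteq> jordan_labels" "set ls' \<subseteq> jordan_labels"
  shows "mset ls = mset ls'"
proof (rule multiset_eqI)
  fix l :: "nat \<times> complex"
  have inv: "apsnd cnj (apsnd cnj x) = x" for x :: "nat \<times> complex" by (cases x) simp
  have cnt: "count (mset (map (apsnd cnj) xs)) x = count (mset xs) (apsnd cnj x)"
    for x :: "nat \<times> complex" and xs
  proof (induction xs)
    case (Cons a xs)
    have "apsnd cnj a = x \<longleftrightarrow> a = apsnd cnj x" using inv by metis
    then show ?case using Cons by simp
  qed simp
  have eq: "count (mset ls) l + count (mset ls) (apsnd cnj l) =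
      count (mset ls') l + count (mset ls') (apsnd cnj l)"
    using arg_cong[OF assms(1), of "\<lambda>M. count M l"] by (simp only: mset_append count_union cnt)
  have zero: "count (mset xs) x = 0" if "set xs \<subseteq> jordan_labels" "Im (snd x) < 0" for xs x
  proof -
    have "x \<notin> set xs" using that by (auto simp: jordan_labels_def)
    then show ?thesis by (simp add: count_eq_zero_iff[THEN iffD2])
  qed
  consider "Im (snd l) < 0" | "Im (snd l) > 0" | "Im (snd l) = 0" by linarith
  then show "count (mset ls) l = count (mset ls') l"
  proof cases
    case 1
    then show ?thesis using zero assms(2,3) by metis
  next
    case 2
    then show ?thesis using eq zero[of ls "apsnd cnj l"] zero[of ls' "apsnd cnj l"] assms(2,3) by simp
  next
    case 3
    then have "apsnd cnj l = l" by (cases l) (simp add: complex_eq_iff)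
    then show ?thesis using eq by simp
  qed
qed

lemma map_mat_diag_block_mat:
  assumes "f 0 = 0"
  shows "map_mat f (diag_block_mat Xs) = diag_block_mat (map (map_mat f) Xs)"
proof (induction Xs)
  case Nil
  show ?case by (auto intro: eq_matI)
next
  case (Cons X Xs)
  have dims: "dim_row (diag_block_mat (map (map_mat f) Xs)) = dim_row (diag_block_mat Xs)"
    "dim_col (diag_block_mat (map (map_mat f) Xs)) = dim_col (diag_block_mat Xs)"
    using arg_cong[OF Cons, of dim_row] arg_cong[OF Cons, of dim_col] by simp_all
  show ?case
    unfolding list.map diag_block_mat.simps Let_def dims Cons[symmetric]
    by (rule eq_matI) (auto simp: assms)
qed

lemma map_mat_jordan_block:
  "f 0 = 0 \<Longrightarrow> f 1 = 1 \<Longrightarrow> map_mat f (jordan_block m a) = jordan_block m (f a)"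
  by (rule eq_matI) (auto simp: jordan_block_def)

lemma map_mat_jordan_matrix:
  assumes "f 0 = 0" "f 1 = 1"
  shows "map_mat f (jordan_matrix ls) = jordan_matrix (map (apsnd f) ls)"
  using assms
  by (simp add: jordan_matrix_def map_mat_diag_block_mat map_mat_jordan_block comp_def case_prod_unfold)

lemma jordan_matrix_append:
  "four_block_mat (jordan_matrix ls) (0\<^sub>m (sum_list (map fst ls)) (sum_list (map fst ls')))
    (0\<^sub>m (sum_list (map fst ls')) (sum_list (map fst ls))) (jordan_matrix ls') = jordan_matrix (ls @ ls')"
  using jordan_matrix_dim[of ls] jordan_matrix_dim[of ls']
  by (simp add: jordan_matrix_def diag_block_mat_append Let_def)


section \<open>Quaternionic matrices as complex matrices of twice the size\<close>

interpretation quat_of_complex: semiring_hom quat_of_complex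
  by unfold_locales (auto simp: quat_of_complex_def quat_ops_defs)

text \<open>The first coordinate \<open>u\<close> in \<open>q = u + v j\<close> with
  \<open>u\<close>, \<open>v\<close> complex; as \<open>i j = k\<close>, the second one collects the
  coefficients of \<open>j\<close> and \<open>k\<close>.\<close>

definition quat_fst :: "quat \<Rightarrow> complex"
  where "quat_fst q = Complex (QRe q) (QI q)"

definition quat_snd :: "quat \<Rightarrow> complex"
  where "quat_snd q = Complex (QJ q) (QK q)"

text \<open>Made for the rule \<open>(u + v j) (u' + v' j) = (u u' - v cnj v') + (u v' + v cnj u')
  j\<close>, in which each coordinate of a product is a sum of two products of coordinates.\<close>

lemma map_mat_mult_split:
  fixes A B :: "'a::semiring_1 mat" and h :: "'a \<Rightarrow> 'b::semiring_1"
  assumes "A \<in> carrier_mat n k" "B \<in> carrier_mat k m"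
    and "h 0 = 0" "\<And>x y. h (x + y) = h x + h y"
    and "\<And>x y. h (x * y) = f1 x * g1 y + f2 x * g2 y"
  shows "map_mat h (A * B) = map_mat f1 A * map_mat g1 B + map_mat f2 A * map_mat g2 B"
proof (rule eq_matI)
  fix i j
  assume "i < dim_row (map_mat f1 A * map_mat g1 B + map_mat f2 A * map_mat g2 B)"
    "j < dim_col (map_mat f1 A * map_mat g1 B + map_mat f2 A * map_mat g2 B)"
  then have ij: "i < n" "j < m" using assms by auto
  have "map_mat h (A * B) $$ (i, j) = h (\<Sum>l = 0..<k. A $$ (i, l) * B $$ (l, j))"
    using ij assms(1,2) by (simp add: scalar_prod_def)
  also have "\<dots> = (\<Sum>l = 0..<k. h (A $$ (i, l) * B $$ (l, j)))"
    by (simp add: sum_comp_morphism[of h, OF assms(3,4), symmetric] comp_def)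
  also have "\<dots> = (map_mat f1 A * map_mat g1 B + map_mat f2 A * map_mat g2 B) $$ (i, j)"
    using ij assms(1,2) by (simp add: scalar_prod_def assms(5) sum.distrib)
  finally show "map_mat h (A * B) $$ (i, j) =
      (map_mat f1 A * map_mat g1 B + map_mat f2 A * map_mat g2 B) $$ (i, j)" .
qed (use assms in auto)

text \<open>The embedding of \<open>u + v j\<close> as the complex matrix with rows \<open>(u, v)\<close> and
  \<open>(- cnj v, cnj u)\<close>, applied to whole matrices rather than entrywise, so that
  a complex matrix \<open>M\<close> becomes block diagonal with blocks \<open>M\<close> and \<open>cnj M\<close>.\<close>

definition complex_rep :: "quat mat \<Rightarrow> complex mat"
  where "complex_rep A = four_block_mat (map_mat quat_fst A) (map_mat quat_snd A)
    (map_mat (\<lambda>q. - cnj (quat_snd q)) A) (map_mat (\<lambda>q. cnj (quat_fst q)) A)"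

lemma complex_rep_carrier: "A \<in> carrier_mat n n \<Longrightarrow> complex_rep A \<in> carrier_mat (n + n) (n + n)"
  by (simp add: complex_rep_def)

lemma complex_rep_of_complex:
  assumes "M \<in> carrier_mat n n"
  shows "complex_rep (map_mat quat_of_complex M) =
    four_block_mat M (0\<^sub>m n n) (0\<^sub>m n n) (map_mat cnj M)"
  unfolding complex_rep_def using assms
  by (intro cong_four_block_mat eq_matI)
    (auto simp: quat_fst_def quat_snd_def quat_of_complex_def complex_eq_iff)

lemma complex_rep_one: "complex_rep (1\<^sub>m n) = 1\<^sub>m (n + n)"
proof -
  have "complex_rep (1\<^sub>m n) = four_block_mat (1\<^sub>m n) (0\<^sub>m n n) (0\<^sub>m n n) (map_mat cnj (1\<^sub>m n))"
    using complex_rep_of_complex[of "1\<^sub>m n" n] by (simp add: quat_of_complex.mat_hom_one)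
  also have "map_mat cnj (1\<^sub>m n) = 1\<^sub>m n" by (rule eq_matI) auto
  finally show ?thesis by simp
qed

lemma complex_rep_mult:
  assumes A: "A \<in> carrier_mat n n" and B: "B \<in> carrier_mat n n"
  shows "complex_rep (A * B) = complex_rep A * complex_rep B"
proof -
  note defs = quat_fst_def quat_snd_def quat_ops_defs complex_eq_iff algebra_simps
  show ?thesis
    unfolding complex_rep_def
  proof (subst mult_four_block_mat[of _ n n _ n _ n _ _ n _ n], goal_cases)
    case 9
    show ?case
      by (intro cong_four_block_mat map_mat_mult_split[OF A B]) (simp_all add: defs)
  qed (use A B in auto)
qed

lemma similar_complex_rep:
  assumes "similar_mat A B"
  shows "similar_mat (complex_rep A) (complex_rep B)"
proof -
  obtain n where "A \<in> carrier_mat n n" using similar_matD[OF assms] by blast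
  then show ?thesis
    by (rule similar_mat_image[where F = complex_rep, OF assms _ complex_rep_carrier complex_rep_one
        complex_rep_mult])
qed

text \<open>Conjugation by \<open>j\<close> sends a complex number \<open>z\<close> to
  \<open>cnj z\<close> and fixes the entries \<open>0\<close> and \<open>1\<close>.\<close>

lemma similar_jordan_block_quat_cnj:
  "similar_mat (jordan_block m (quat_of_complex (cnj z))) (jordan_block m (quat_of_complex z))"
proof -
  have "similar_mat (mat m m (\<lambda>(i, j). Quat 0 0 1 0 * jordan_block m (quat_of_complex z) $$ (i, j) *
      Quat 0 0 (- 1) 0)) (jordan_block m (quat_of_complex z))"
    by (rule similar_mat_diagonal_conj) (simp_all add: quat_ops_defs)
  also have "mat m m (\<lambda>(i, j). Quat 0 0 1 0 * jordan_block m (quat_of_complex z) $$ (i, j) *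
      Quat 0 0 (- 1) 0) = jordan_block m (quat_of_complex (cnj z))"
    by (rule eq_matI) (auto simp: jordan_block_def quat_of_complex_def quat_ops_defs)
  finally show ?thesis .
qed

text \<open>The complex statement, whose proof uses a determinant, is transported along the
  embedding of the complex numbers.\<close>

lemma inverse_similar_jordan_block_quat:
  assumes "z \<noteq> 0"
  shows "inverse_similar (jordan_block m (quat_of_complex z)) (jordan_block m (quat_of_complex (inverse z)))"
  using inverse_similar_image[OF inverse_similar_jordan_block[OF assms], of m m "map_mat quat_of_complex"]
    quat_of_complex.mat_hom_mult[of _ m m _ m]
  by (simp add: quat_of_complex.mat_hom_one map_mat_jordan_block)

text \<open>The complex representation carries every label together with its conjugate, so a real
  eigenvalue appears twice; this is the closure undone by
  \<open>mset_eq_if_conjugate_closure_eq\<close>.\<close>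

lemma similar_quat_jordan_blocks_unique:
  assumes "similar_mat (diag_block_mat (map (\<lambda>(m, z). jordan_block m (quat_of_complex z)) ls))
      (diag_block_mat (map (\<lambda>(m, z). jordan_block m (quat_of_complex z)) ls'))"
    and "set ls \<subseteq> jordan_labels" "set ls' \<subseteq> jordan_labels"
  shows "mset ls = mset ls'"
proof -
  have eq: "complex_rep (diag_block_mat (map (\<lambda>(m, z). jordan_block m (quat_of_complex z)) xs))
      = jordan_matrix (xs @ map (apsnd cnj) xs)" for xs
  proof -
    have "diag_block_mat (map (\<lambda>(m, z). jordan_block m (quat_of_complex z)) xs) =
        map_mat quat_of_complex (jordan_matrix xs)"
      by (simp add: map_mat_jordan_matrix) (simp add: jordan_matrix_def comp_def case_prod_unfold)
    then show ?thesis
      using complex_rep_of_complex[OF jordan_matrix_carrier, of xs]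
        jordan_matrix_append[of xs "map (apsnd cnj) xs"]
      by (simp add: map_mat_jordan_matrix comp_def)
  qed
  have "similar_mat (jordan_matrix (ls @ map (apsnd cnj) ls)) (jordan_matrix (ls' @ map (apsnd cnj) ls'))"
    using similar_complex_rep[OF assms(1)] by (simp only: eq)
  then have "mset (ls @ map (apsnd cnj) ls) = mset (ls' @ map (apsnd cnj) ls')"
    by (rule jordan_matrix_unique) (use assms(2,3) in \<open>auto simp: jordan_labels_def\<close>)
  then show ?thesis using assms(2,3) by (rule mset_eq_if_conjugate_closure_eq)
qed

section \<open>Real Jordan blocks\<close>

lemma psi_index:
  assumes "r < 2" "s < 2"
  shows "psi z $$ (r, s) = (if r = s then Re z else if r = 0 then Im z else - Im z)"
proof -
  have "r = 0 \<or> r = 1" "s = 0 \<or> s = 1" using assms by linarith+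
  then show ?thesis by (auto simp: psi_def mat_of_rows_list_def)
qed

lemma Psi_dim [simp]: "dim_row (Psi A) = 2 * dim_row A" "dim_col (Psi A) = 2 * dim_col A"
  by (simp_all add: Psi_def)

lemma Psi_carrier: "A \<in> carrier_mat n m \<Longrightarrow> Psi A \<in> carrier_mat (2 * n) (2 * m)"
  by (simp add: Psi_def)

lemma Psi_index:
  assumes "i < 2 * dim_row A" "j < 2 * dim_col A"
  shows "Psi A $$ (i, j) = psi (A $$ (i div 2, j div 2)) $$ (i mod 2, j mod 2)"
  using assms by (simp add: Psi_def)

lemma sum_even_odd:
  fixes f :: "nat \<Rightarrow> 'a::comm_monoid_add"
  shows "sum f {0..<2 * n} = (\<Sum>k = 0..<n. f (2 * k) + f (2 * k + 1))"
  by (induction n) (simp_all add: add.assoc)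

lemma sum_halves:
  fixes f :: "nat \<Rightarrow> 'a::comm_monoid_add"
  shows "sum f {0..<n + n} = (\<Sum>k = 0..<n. f k + f (n + k))"
proof -
  have "sum f {n..<n + n} = (\<Sum>k = 0..<n. f (n + k))"
    using sum.shift_bounds_nat_ivl[of f 0 n n] by (simp add: add.commute)
  then show ?thesis
    using sum.atLeastLessThan_concat[of 0 n "n + n" f] by (simp add: sum.distrib)
qed

lemma psi_sum:
  assumes "r < 2" "s < 2"
  shows "psi (sum f S) $$ (r, s) = (\<Sum>x\<in>S. psi (f x) $$ (r, s))"
  using assms by (simp add: psi_index Re_sum Im_sum sum_negf)

lemma psi_mult:
  assumes "r < 2" "s < 2"
  shows "psi (z * w) $$ (r, s) =
    psi z $$ (r, 0) * psi w $$ (0, s) + psi z $$ (r, 1) * psi w $$ (1, s)"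
  using assms by (auto simp: psi_index less_2_cases_iff)

lemma Psi_mult:
  assumes A: "A \<in> carrier_mat n k" and B: "B \<in> carrier_mat k m"
  shows "Psi (A * B) = Psi A * Psi B"
proof (rule eq_matI)
  fix i j assume "i < dim_row (Psi A * Psi B)" "j < dim_col (Psi A * Psi B)"
  then have ij: "i < 2 * n" "j < 2 * m" using A B by auto
  then have d: "i div 2 < n" "j div 2 < m" by auto
  have "Psi (A * B) $$ (i, j) =
      psi (\<Sum>l = 0..<k. A $$ (i div 2, l) * B $$ (l, j div 2)) $$ (i mod 2, j mod 2)"
    using ij d A B by (simp add: Psi_index scalar_prod_def)
  \<comment> \<open>The indices \<open>2 l\<close> and \<open>2 l + 1\<close> together give the 2x2
    product \<open>psi z\<close> times \<open>psi w\<close> of one summand.\<close>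
  also have "\<dots> = (\<Sum>l = 0..<2 * k. Psi A $$ (i, l) * Psi B $$ (l, j))"
    unfolding sum_even_odd
    using ij A B by (auto simp: psi_sum psi_mult Psi_index intro!: sum.cong)
  also have "\<dots> = (Psi A * Psi B) $$ (i, j)"
    using ij A B by (simp add: scalar_prod_def)
  finally show "Psi (A * B) $$ (i, j) = (Psi A * Psi B) $$ (i, j)" .
qed simp_all

lemma Psi_one: "Psi (1\<^sub>m n) = 1\<^sub>m (2 * n)"
proof (rule eq_matI)
  fix i j assume "i < dim_row (1\<^sub>m (2 * n) :: real mat)" "j < dim_col (1\<^sub>m (2 * n) :: real mat)"
  then have ij: "i < 2 * n" "j < 2 * n" "i div 2 < n" "j div 2 < n" by auto
  have "i = j \<longleftrightarrow> i div 2 = j div 2 \<and> i mod 2 = j mod 2" by (metis div_mult_mod_eq)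
  then show "Psi (1\<^sub>m n) $$ (i, j) = 1\<^sub>m (2 * n) $$ (i, j)"
    using ij by (auto simp: Psi_index psi_index)
qed simp_all

text \<open>Conjugation by the diagonal matrix with entries 1, -1, 1, -1, ... flips the off-diagonal
  signs in each 2x2 block, which negates the imaginary part.\<close>

lemma similar_Psi_cnj:
  assumes A: "A \<in> carrier_mat n n"
  shows "similar_mat (Psi (map_mat cnj A)) (Psi A)"
proof -
  have "similar_mat (mat (2 * n) (2 * n) (\<lambda>(i, j). (- 1) ^ i * Psi A $$ (i, j) * (- 1) ^ j)) (Psi A)"
    by (rule similar_mat_diagonal_conj[OF Psi_carrier[OF A]])
      (simp_all flip: power_mult_distrib)
  also have "mat (2 * n) (2 * n) (\<lambda>(i, j). (- 1) ^ i * Psi A $$ (i, j) * (- 1) ^ j) = Psi (map_mat cnj A)"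
  proof (rule eq_matI)
    fix i j assume "i < dim_row (Psi (map_mat cnj A))" "j < dim_col (Psi (map_mat cnj A))"
    then have ij: "i < 2 * n" "j < 2 * n" "i div 2 < n" "j div 2 < n" using A by auto
    then show "mat (2 * n) (2 * n) (\<lambda>(i, j). (- 1) ^ i * Psi A $$ (i, j) * (- 1) ^ j) $$ (i, j) =
        Psi (map_mat cnj A) $$ (i, j)"
      using A by (cases "even i"; cases "even j") (auto simp: Psi_index psi_index even_iff_mod_2_eq_zero odd_iff_mod_2_eq_one)
  qed (use A in auto)
  finally show ?thesis .
qed

lemma inverse_similar_Psi_jordan_block:
  assumes "z \<noteq> 0"
  shows "inverse_similar (Psi (jordan_block m z)) (Psi (jordan_block m (inverse z)))"
  by (rule inverse_similar_image[OF inverse_similar_jordan_block[OF assms] jordan_block_carrier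
        Psi_carrier Psi_one Psi_mult])

text \<open>The vectors \<open>(1, i)\<close> and \<open>(1, -i)\<close> are eigenvectors of every \<open>psi z\<close>, with eigenvalues
  \<open>z\<close> and \<open>cnj z\<close>.\<close>

lemma similar_complexified_Psi:
  assumes A: "A \<in> carrier_mat n n"
  shows "similar_mat (map_mat complex_of_real (Psi A))
    (four_block_mat A (0\<^sub>m n n) (0\<^sub>m n n) (map_mat cnj A))"
proof -
  define w where "w = (\<lambda>r::nat. if r = 0 then 1 else \<i>)"
  define p where "p = (\<lambda>i l. if l < n then if i div 2 = l then w (i mod 2) else 0
    else if i div 2 = l - n then cnj (w (i mod 2)) else 0)"
  define P where "P = mat (n + n) (n + n) (\<lambda>(i, l). p i l)"
  \<comment> \<open>The columns of \<open>P\<close> are pairwise orthogonal of squared length 2,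
    hence half the conjugate transpose inverts \<open>P\<close>.\<close>
  define Q where "Q = mat (n + n) (n + n) (\<lambda>(l, i). cnj (p i l) / 2)"
  define F where "F = four_block_mat A (0\<^sub>m n n) (0\<^sub>m n n) (map_mat cnj A)"
  define C where "C = map_mat complex_of_real (Psi A)"
  have P: "P \<in> carrier_mat (n + n) (n + n)" and Q: "Q \<in> carrier_mat (n + n) (n + n)"
    and F: "F \<in> carrier_mat (n + n) (n + n)" and C: "C \<in> carrier_mat (n + n) (n + n)"
    using A by (auto simp: P_def Q_def F_def C_def)
  have [simp]: "p (2 * k) l = (if l < n then if k = l then 1 else 0 else if k = l - n then 1 else 0)"
    "p (Suc (2 * k)) l = (if l < n then if k = l then \<i> else 0 else if k = l - n then - \<i> else 0)"
    for k l by (auto simp: p_def w_def)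
  \<comment> \<open>Row \<open>r\<close> of the two eigenvector equations; \<open>w r\<close> is
    entry \<open>r\<close> of \<open>(1, i)\<close>.\<close>
  have psi_w: "complex_of_real (psi z $$ (r, 0)) + complex_of_real (psi z $$ (r, Suc 0)) * \<i> = z * w r"
    "complex_of_real (psi z $$ (r, 0)) - complex_of_real (psi z $$ (r, Suc 0)) * \<i> = cnj z * cnj (w r)"
    if "r < 2" for z r
    using that by (auto simp: psi_index w_def complex_eq_iff less_2_cases_iff)
  have QP: "Q * P = 1\<^sub>m (n + n)"
  proof (rule eq_matI)
    fix l l' assume "l < dim_row (1\<^sub>m (n + n) :: complex mat)" "l' < dim_col (1\<^sub>m (n + n) :: complex mat)"
    then have l: "l < n + n" "l' < n + n" by auto
    have "(Q * P) $$ (l, l') = (\<Sum>i = 0..<2 * n. cnj (p i l) / 2 * p i l')"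
      using l by (simp add: Q_def P_def scalar_prod_def mult_2)
    \<comment> \<open>Rows \<open>2 k\<close> and \<open>2 k + 1\<close> are combined. A column with
      itself gives 1/2 + 1/2; the columns of two conjugate eigenvectors give 1/2 - 1/2.\<close>
    also have "\<dots> = (\<Sum>k = 0..<n. if k = (if l < n then l else l - n) then
        if l = l' then 1 else 0 else 0)"
      unfolding sum_even_odd using l by (intro sum.cong) auto
    also have "\<dots> = 1\<^sub>m (n + n) $$ (l, l')" using l by auto
    finally show "(Q * P) $$ (l, l') = 1\<^sub>m (n + n) $$ (l, l')" .
  qed (use P Q in auto)
  have PQ: "P * Q = 1\<^sub>m (n + n)" by (rule mat_mult_left_right_inverse[OF Q P QP])
  have CP: "C * P = P * F"
  proof (rule eq_matI)
    fix i l assume "i < dim_row (P * F)" "l < dim_col (P * F)"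
    then have il: "i < n + n" "l < n + n" "i div 2 < n" using P F by auto
    let ?l = "if l < n then l else l - n"
    let ?z = "A $$ (i div 2, ?l)"
    have l: "?l < n" using il by auto
    have "(C * P) $$ (i, l) = (\<Sum>k = 0..<2 * n. complex_of_real (Psi A $$ (i, k)) * p k l)"
      using il A by (simp add: C_def P_def scalar_prod_def mult_2)
    also have "\<dots> = (\<Sum>k = 0..<n. if k = ?l then
        complex_of_real (psi ?z $$ (i mod 2, 0)) + complex_of_real (psi ?z $$ (i mod 2, 1)) *
          (if l < n then \<i> else - \<i>) else 0)"
      unfolding sum_even_odd using il A by (intro sum.cong) (auto simp: Psi_index)
    also have "\<dots> = (if l < n then ?z * w (i mod 2) else cnj ?z * cnj (w (i mod 2)))"
      using l psi_w[of "i mod 2" ?z] by (cases "l < n") simp_all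
    \<comment> \<open>The value is expanded again, now towards \<open>P * F\<close>: row
      \<open>i\<close> of \<open>P\<close> meets only the rows \<open>i div 2\<close> and
      \<open>n + i div 2\<close> of \<open>F\<close>, and in column \<open>l\<close> one of these
      entries is zero.\<close>
    also have "\<dots> = (\<Sum>k = 0..<n. if k = i div 2 then
        (if l < n then ?z * w (i mod 2) else cnj ?z * cnj (w (i mod 2))) else 0)"
      using il by simp
    also have "\<dots> = (\<Sum>k = 0..<n + n. p i k * F $$ (k, l))"
      unfolding sum_halves using il A by (intro sum.cong) (auto simp: F_def p_def)
    also have "\<dots> = (P * F) $$ (i, l)"
      using il F by (simp add: P_def scalar_prod_def)
    finally show "(C * P) $$ (i, l) = (P * F) $$ (i, l)" .
  qed (use P F C in auto)
  have "C = C * (P * Q)" using C PQ by simp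
  also have "\<dots> = C * P * Q" by (rule assoc_mult_mat[OF C P Q, symmetric])
  also have "\<dots> = P * F * Q" by (simp only: CP)
  finally have "similar_mat C F"
    using P Q F C PQ QP by (intro similar_matI[of _ _ P Q "n + n"]) auto
  then show ?thesis by (simp add: C_def F_def)
qed

definition real_block :: "nat \<times> complex \<Rightarrow> real mat"
  where "real_block = (\<lambda>(m, z). if Im z = 0 then jordan_block m (Re z) else Psi (jordan_block m z))"

text \<open>A real eigenvalue is listed once here, in contrast to the quaternionic case, because its
  real block already has the size \<open>m\<close> of the complex one.\<close>

definition complexified_labels :: "nat \<times> complex \<Rightarrow> (nat \<times> complex) list"
  where "complexified_labels l = (if Im (snd l) = 0 then [l] else [l, apsnd cnj l])"

lemma jordan_matrix_singleton: "jordan_matrix [(m, z)] = jordan_block m z"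
  unfolding jordan_matrix_def list.map prod.case by (rule diag_block_mat_singleton)

lemma similar_complexified_real_block:
  "similar_mat (map_mat complex_of_real (real_block l)) (jordan_matrix (complexified_labels l))"
proof -
  obtain m z where l: "l = (m, z)" by force
  show ?thesis
  proof (cases "Im z = 0")
    case True
    then have "complex_of_real (Re z) = z" by (simp add: complex_eq_iff)
    then have "map_mat complex_of_real (real_block l) = jordan_block m z"
      using True by (simp add: l real_block_def map_mat_jordan_block)
    then show ?thesis
      using True similar_mat_refl[OF jordan_block_carrier]
      by (simp add: l complexified_labels_def jordan_matrix_singleton)
  next
    case False
    have "four_block_mat (jordan_block m z) (0\<^sub>m m m) (0\<^sub>m m m) (map_mat cnj (jordan_block m z))
        = jordan_matrix [(m, z), (m, cnj z)]"
      using jordan_matrix_append[of "[(m, z)]" "[(m, cnj z)]"]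
      by (simp add: map_mat_jordan_block jordan_matrix_singleton)
    then show ?thesis
      using similar_complexified_Psi[OF jordan_block_carrier[of m z]] False
      by (simp add: l real_block_def complexified_labels_def)
  qed
qed

text \<open>Complexification adds exactly the conjugates of the non-real labels, so discarding
  negative imaginary parts recovers the original list.\<close>

lemma similar_real_blocks_unique:
  assumes "similar_mat (diag_block_mat (map real_block ls)) (diag_block_mat (map real_block ls'))"
    and "set ls \<subseteq> jordan_labels" "set ls' \<subseteq> jordan_labels"
  shows "mset ls = mset ls'"
proof -
  let ?c = "\<lambda>xs. concat (map complexified_labels xs)"
  have sim: "similar_mat (map_mat complex_of_real (diag_block_mat (map real_block xs)))
      (jordan_matrix (?c xs))" for xs
    unfolding jordan_matrix_concat_diag_block_mat
    by (subst map_mat_diag_block_mat)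
      (auto simp: list_all2_map1 list_all2_map2 similar_complexified_real_block
        intro!: similar_diag_block_mat list.rel_refl)
  obtain n where "diag_block_mat (map real_block ls) \<in> carrier_mat n n"
    using similar_matD[OF assms(1)] by blast
  then have "similar_mat (map_mat complex_of_real (diag_block_mat (map real_block ls)))
      (map_mat complex_of_real (diag_block_mat (map real_block ls')))"
    by (rule similar_mat_image[where F = "map_mat complex_of_real", OF assms(1)])
      (auto simp: of_real_hom.mat_hom_one intro: of_real_hom.mat_hom_mult)
  from similar_mat_trans[OF similar_mat_trans[OF similar_mat_sym[OF sim] this] sim]
  have "similar_mat (jordan_matrix (?c ls)) (jordan_matrix (?c ls'))" .
  then have "mset (?c ls) = mset (?c ls')"
    by (rule jordan_matrix_unique)
      (use assms(2,3) in \<open>auto simp: jordan_labels_def complexified_labels_def split: if_splits\<close>)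
  then have "mset (filter (\<lambda>l. Im (snd l) \<ge> 0) (?c ls)) = mset (filter (\<lambda>l. Im (snd l) \<ge> 0) (?c ls'))"
    by simp
  moreover have "filter (\<lambda>l. Im (snd l) \<ge> 0) (?c xs) = xs" if "set xs \<subseteq> jordan_labels" for xs
    using that by (induction xs) (auto simp: jordan_labels_def complexified_labels_def)
  ultimately show ?thesis using assms(2,3) by simp
qed

section \<open>Reversibility\<close>

lemma blocks_R_eq: "blocks_R = real_block ` jordan_labels"
proof (intro equalityI subsetI)
  fix X assume "X \<in> blocks_R"
  then consider m a where "X = jordan_block m a" "m > 0"
    | l \<mu> \<nu> where "X = real_jordan_pm l \<mu> \<nu>" "l > 0" "\<nu> > 0"
    unfolding blocks_R_def by blast
  then show "X \<in> real_block ` jordan_labels"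
  proof cases
    case (1 m a)
    then have "X = real_block (m, complex_of_real a)" by (simp add: real_block_def)
    then show ?thesis using 1 by (auto simp: jordan_labels_def)
  next
    case (2 l \<mu> \<nu>)
    then have "X = real_block (l, Complex \<mu> \<nu>)" by (simp add: real_block_def real_jordan_pm_def)
    then show ?thesis using 2 by (auto simp: jordan_labels_def)
  qed
next
  fix X assume "X \<in> real_block ` jordan_labels"
  then obtain m z where X: "X = real_block (m, z)" and m: "m > 0" and z: "Im z \<ge> 0"
    by (auto simp: jordan_labels_def)
  show "X \<in> blocks_R"
  proof (cases "Im z = 0")
    case True
    then have "X = jordan_block m (Re z)" using X by (simp add: real_block_def)
    then show ?thesis using m unfolding blocks_R_def by blast
  next
    case False
    then have "X = real_jordan_pm m (Re z) (Im z)" "Im z > 0"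
      using X z by (simp_all add: real_block_def real_jordan_pm_def)
    then show ?thesis using m unfolding blocks_R_def by blast
  qed
qed

lemma blocks_H_eq: "blocks_H = (\<lambda>(m, z). jordan_block m (quat_of_complex z)) ` jordan_labels"
  by (auto simp: blocks_H_def jordan_labels_def)

text \<open>The origin of the parameters of the second block in a real pair; the minus sign is why
  that block appears in its \<open>mp\<close> form.\<close>

lemma inverse_Complex: "inverse (Complex x y) = Complex (x / (x\<^sup>2 + y\<^sup>2)) (- (y / (x\<^sup>2 + y\<^sup>2)))"
  by (simp add: complex_eq_iff)

lemma similar_Psi_jordan_block_cnj:
  "similar_mat (Psi (jordan_block m (cnj z))) (Psi (jordan_block m z))"
  using similar_Psi_cnj[OF jordan_block_carrier[of m z]] by (simp add: map_mat_jordan_block)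

text \<open>As \<open>z * cnj z\<close> is the squared modulus, the fixed points of
  \<open>\<sigma>\<close> over the reals and the quaternions are the labels on the unit
  circle.\<close>

lemma inverse_cnj_eq_iff:
  assumes "z \<noteq> 0"
  shows "inverse (cnj z) = z \<longleftrightarrow> cmod z = 1"
proof -
  have "inverse (cnj z) = z \<longleftrightarrow> z * cnj z = 1"
    using assms by (auto simp: field_simps)
  also have "\<dots> \<longleftrightarrow> (cmod z)\<^sup>2 = 1"
    by (metis complex_norm_square of_real_1 of_real_eq_iff)
  finally show ?thesis by (simp add: power2_eq_1_iff) (use norm_ge_zero[of z] in linarith)
qed

lemma real_block_of_real: "real_block (m, complex_of_real x) = jordan_block m x"
  by (simp add: real_block_def)

text \<open>For non-real \<open>z\<close> the inverse is similar to \<open>Psi\<close> of the block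
  of \<open>1/z\<close>, and a conjugation replaces this by \<open>1/cnj z\<close>; for real
  \<open>z\<close> the two eigenvalues coincide.\<close>

lemma inverse_similar_real_block:
  assumes "z \<noteq> 0"
  shows "inverse_similar (real_block (m, z)) (real_block (m, inverse (cnj z)))"
proof (cases "Im z = 0")
  case True
  then have z: "z = complex_of_real (Re z)" by (simp add: complex_eq_iff)
  then have "Re z \<noteq> 0" using assms by (metis of_real_0)
  have "inverse (cnj z) = complex_of_real (inverse (Re z))" by (subst z) simp
  moreover have "real_block (m, z) = jordan_block m (Re z)" using True by (simp add: real_block_def)
  ultimately show ?thesis
    using inverse_similar_jordan_block[OF \<open>Re z \<noteq> 0\<close>] by (simp only: real_block_of_real)
next
  case False
  have "similar_mat (Psi (jordan_block m (inverse z))) (Psi (jordan_block m (inverse (cnj z))))"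
    using similar_Psi_jordan_block_cnj[of m "inverse (cnj z)"] by simp
  moreover have "Im (inverse (cnj z)) \<noteq> 0" using False by simp
  ultimately show ?thesis
    using False inverse_similar_trans[OF inverse_similar_Psi_jordan_block[OF assms]]
    unfolding real_block_def by (simp only: prod.case if_False)
qed

lemma inverse_similar_pair_R:
  assumes "pair_R X Y"
  shows "inverse_similar X Y"
proof -
  have *: "inverse_similar X Y"
    if "similar_mat X X'" "similar_mat Y Y'" "inverse_similar X' Y'" for X' Y'
    using that similar_mat_sym inverse_similar_trans inverse_similar_trans_left by blast
  show ?thesis
    using assms unfolding pair_R_def
  proof (elim disjE exE conjE)
    fix \<mu> \<nu> :: real and t
    assume "\<nu> > 0" and X: "similar_mat X (real_jordan_pm t \<mu> \<nu>)"
      and Y: "similar_mat Y (real_jordan_mp t (\<mu> / (\<mu>\<^sup>2 + \<nu>\<^sup>2)) (\<nu> / (\<mu>\<^sup>2 + \<nu>\<^sup>2)))"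
    have "Complex \<mu> \<nu> \<noteq> 0" using \<open>\<nu> > 0\<close> by (simp add: complex_eq_iff)
    then show ?thesis
      using *[OF X Y] inverse_similar_Psi_jordan_block[of "Complex \<mu> \<nu>" t]
      by (simp add: real_jordan_pm_def real_jordan_mp_def inverse_Complex)
  next
    fix a s assume "a \<noteq> 0" "similar_mat X (jordan_block s a)" "similar_mat Y (jordan_block s (inverse a))"
    then show ?thesis using * inverse_similar_jordan_block by blast
  qed
qed

lemma inverse_similar_single_R:
  assumes "single_R X"
  shows "inverse_similar X X"
proof -
  have *: "inverse_similar X X" if "similar_mat X X'" "inverse_similar X' X'" for X'
    using that similar_mat_sym inverse_similar_trans inverse_similar_trans_left by blast
  show ?thesis
    using assms unfolding single_R_def
  proof (elim disjE exE conjE)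
    fix \<alpha> \<beta> :: real and l
    assume "\<beta> > 0" "\<alpha>\<^sup>2 + \<beta>\<^sup>2 = 1" and X: "similar_mat X (real_jordan_pm l \<alpha> \<beta>)"
    let ?z = "Complex \<alpha> \<beta>"
    have "?z \<noteq> 0" using \<open>\<beta> > 0\<close> by (simp add: complex_eq_iff)
    \<comment> \<open>On the unit circle inversion is conjugation, and conjugate eigenvalues give
      similar real blocks.\<close>
    moreover have "inverse ?z = cnj ?z"
      using \<open>\<alpha>\<^sup>2 + \<beta>\<^sup>2 = 1\<close> by (simp add: inverse_Complex complex_eq_iff)
    ultimately have "inverse_similar (Psi (jordan_block l ?z)) (Psi (jordan_block l ?z))"
      using inverse_similar_Psi_jordan_block similar_Psi_jordan_block_cnj inverse_similar_trans by metis
    then show ?thesis using *[OF X] by (simp add: real_jordan_pm_def)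
  next
    fix \<gamma> :: real and m
    assume X: "similar_mat X (jordan_block m \<gamma>)" and "\<gamma> = 1"
    then show ?thesis using *[OF X] inverse_similar_jordan_block[of \<gamma> m] by simp
  next
    fix \<gamma> :: real and m
    assume X: "similar_mat X (jordan_block m \<gamma>)" and "\<gamma> = - 1"
    then show ?thesis using *[OF X] inverse_similar_jordan_block[of \<gamma> m] by simp
  qed
qed

section \<open>The criterion over the reals, the complex numbers and the quaternions\<close>

lemma reversible_R_iff:
  assumes "A \<in> carrier (GL n)" "jordan_form blocks_R A Bs"
  shows "reversible (GL n) A \<longleftrightarrow> pairs_and_singletons pair_R single_R Bs"
proof (rule reversible_iff_pairs_and_singletons[where B = real_block and L = jordan_labels and
      \<sigma> = "\<lambda>(m, z). (m, inverse (cnj z))" and I = "{(m, z). z \<noteq> 0}"])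
  show "A \<in> carrier (GL n)" "jordan_form (real_block ` jordan_labels) A Bs"
    using assms by (simp_all add: blocks_R_eq)
next
  fix l :: "nat \<times> complex" and Y
  assume l: "l \<in> jordan_labels" and Y: "Y \<in> carrier_mat (dim_row (real_block l)) (dim_row (real_block l))"
    "real_block l * Y = 1\<^sub>m (dim_row (real_block l))"
  show "l \<in> {(m, z). z \<noteq> 0}"
  proof (rule ccontr)
    assume "l \<notin> {(m, z). z \<noteq> 0}"
    then obtain m where "l = (m, 0)" by (cases l) auto
    then show False using l Y jordan_block_0_not_right_invertible[of Y m]
      by (simp add: real_block_def jordan_labels_def)
  qed
next
  fix l :: "nat \<times> complex"
  assume l': "l \<in> jordan_labels \<inter> {(m, z). z \<noteq> 0}"
  then obtain m z where l: "l = (m, z)" "m > 0" "Im z \<ge> 0" "z \<noteq> 0" by (auto simp: jordan_labels_def)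
  have sq: "(Re z)\<^sup>2 + (Im z)\<^sup>2 = (cmod z)\<^sup>2" by (simp add: cmod_power2)
  have real: "z = complex_of_real (Re z)" "inverse (cnj z) = complex_of_real (inverse (Re z))"
    if "Im z = 0"
  proof -
    show 1: "z = complex_of_real (Re z)" using that by (simp add: complex_eq_iff)
    show "inverse (cnj z) = complex_of_real (inverse (Re z))" by (subst 1) simp
  qed
  show "inverse_similar (real_block l) (real_block (case l of (m, z) \<Rightarrow> (m, inverse (cnj z))))"
    using inverse_similar_real_block l by simp
  show "pair_R (real_block l) (real_block (case l of (m, z) \<Rightarrow> (m, inverse (cnj z))))"
    if "(case l of (m, z) \<Rightarrow> (m, inverse (cnj z))) \<noteq> l"
  proof -
    have ne: "cmod z \<noteq> 1" using that l inverse_cnj_eq_iff by simp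
    show ?thesis
    proof (cases "Im z = 0")
      case True
      note z = real[OF True]
      have "Re z \<noteq> 0" using z(1) l(4) by (metis of_real_0)
      moreover have "\<bar>Re z\<bar> \<noteq> 1" using z(1) ne by (metis norm_of_real)
      moreover have "real_block l = jordan_block m (Re z)" using True l by (simp add: real_block_def)
      moreover have "real_block (m, inverse (cnj z)) = jordan_block m (inverse (Re z))"
        unfolding z(2) by (rule real_block_of_real)
      ultimately show ?thesis
        unfolding pair_R_def l(1) prod.case
        by (intro disjI2 exI[of _ "Re z"] exI[of _ m])
          (auto simp: l(1) intro: similar_mat_refl[OF jordan_block_carrier])
    next
      case False
      have Z: "z = Complex (Re z) (Im z)" by simp
      \<comment> \<open>The partner is labelled by \<open>1/cnj z\<close>, but \<open>pair_R\<close>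
        displays it with the eigenvalue \<open>1/z\<close>; a conjugation mediates.\<close>
      have "similar_mat (Psi (jordan_block m (inverse (cnj z)))) (Psi (jordan_block m (inverse z)))"
        using similar_Psi_jordan_block_cnj[of m "inverse z"] by simp
      moreover have "inverse z = Complex (Re z / ((Re z)\<^sup>2 + (Im z)\<^sup>2)) (- (Im z / ((Re z)\<^sup>2 + (Im z)\<^sup>2)))"
        by (subst Z) (simp only: inverse_Complex)
      moreover have "real_block l = real_jordan_pm m (Re z) (Im z)"
        "real_block (m, inverse (cnj z)) = Psi (jordan_block m (inverse (cnj z)))"
        using False l by (simp_all add: real_block_def real_jordan_pm_def)
      moreover have "(Re z)\<^sup>2 + (Im z)\<^sup>2 \<noteq> 1" "Im z > 0"
        using ne False l(3) norm_ge_zero[of z] unfolding sq power2_eq_1_iff by linarith+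
      moreover have "similar_mat (real_jordan_pm m (Re z) (Im z)) (real_jordan_pm m (Re z) (Im z))"
        unfolding real_jordan_pm_def by (rule similar_mat_refl[OF Psi_carrier[OF jordan_block_carrier]])
      ultimately show ?thesis
        unfolding pair_R_def l(1) prod.case real_jordan_mp_def
        by (intro disjI1 exI[of _ "Re z"] exI[of _ "Im z"] exI[of _ m]) (simp add: l(1))
    qed
  qed
  show "single_R (real_block l)" if "(case l of (m, z) \<Rightarrow> (m, inverse (cnj z))) = l"
  proof -
    have one: "cmod z = 1" using that l inverse_cnj_eq_iff by simp
    show ?thesis
    proof (cases "Im z = 0")
      case True
      then have "\<bar>Re z\<bar> = 1" using real(1) one by (metis norm_of_real)
      then have "Re z = 1 \<or> Re z = - 1" by linarith
      moreover have "real_block l = jordan_block m (Re z)" using True l by (simp add: real_block_def)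
      ultimately show ?thesis
        unfolding single_R_def using similar_mat_refl[OF jordan_block_carrier] by metis
    next
      case False
      have "real_block l = real_jordan_pm m (Re z) (Im z)"
        using False l by (simp add: real_block_def real_jordan_pm_def)
      moreover have "similar_mat (real_jordan_pm m (Re z) (Im z)) (real_jordan_pm m (Re z) (Im z))"
        unfolding real_jordan_pm_def by (rule similar_mat_refl[OF Psi_carrier[OF jordan_block_carrier]])
      moreover have "(Re z)\<^sup>2 + (Im z)\<^sup>2 = 1" "Im z > 0" using sq one False l(3) by simp_all
      ultimately show ?thesis unfolding single_R_def by metis
    qed
  qed
next
  fix l :: "nat \<times> complex"
  assume "l \<in> jordan_labels"
  then show "square_mat (real_block l)" "(case l of (m, z) \<Rightarrow> (m, inverse (cnj z))) \<in> jordan_labels"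
    "(case case l of (m, z) \<Rightarrow> (m, inverse (cnj z)) of (m, z) \<Rightarrow> (m, inverse (cnj z))) = l"
    by (auto simp: real_block_def jordan_labels_def)
qed (erule similar_real_blocks_unique inverse_similar_pair_R inverse_similar_single_R; assumption)+

lemma reversible_C_iff:
  assumes "A \<in> carrier (GL n)" "jordan_form blocks_C A Bs"
  shows "reversible (GL n) A \<longleftrightarrow> pairs_and_singletons pair_C single_C Bs"
proof (rule reversible_iff_pairs_and_singletons[where B = "\<lambda>(m, z). jordan_block m z" and
      L = "{(m, z). m > 0}" and \<sigma> = "apsnd inverse" and I = "{(m, z). z \<noteq> 0}"])
  have "blocks_C = (\<lambda>(m, z). jordan_block m z) ` {(m, z). m > 0}" by (auto simp: blocks_C_def)
  then show "A \<in> carrier (GL n)" "jordan_form ((\<lambda>(m, z). jordan_block m z) ` {(m, z). m > 0}) A Bs"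
    using assms by simp_all
next
  fix ls ls' :: "(nat \<times> complex) list"
  assume "set ls \<subseteq> {(m, z). m > 0}" "set ls' \<subseteq> {(m, z). m > 0}"
    "similar_mat (diag_block_mat (map (\<lambda>(m, z). jordan_block m z) ls))
      (diag_block_mat (map (\<lambda>(m, z). jordan_block m z) ls'))"
  then show "mset ls = mset ls'"
    by (intro jordan_matrix_unique) (auto simp: jordan_matrix_def)
next
  have *: "inverse_similar X Y" if "similar_mat X X'" "similar_mat Y Y'" "inverse_similar X' Y'"
    for X Y X' Y' :: "complex mat"
    using that similar_mat_sym inverse_similar_trans inverse_similar_trans_left by blast
  show "inverse_similar X Y" if "pair_C X Y" for X Y
    using that * inverse_similar_jordan_block unfolding pair_C_def by metis
  show "inverse_similar X X" if X: "single_C X" for X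
  proof -
    obtain a m where a: "a = 1 \<or> a = - 1" "similar_mat X (jordan_block m a)"
      using X unfolding single_C_def by blast
    have "a \<noteq> 0" "inverse a = a" using a(1) by auto
    then show ?thesis using *[OF a(2) a(2)] inverse_similar_jordan_block[of a m] by simp
  qed
next
  fix l :: "nat \<times> complex" and Y
  assume "l \<in> {(m, z). m > 0}"
    "Y \<in> carrier_mat (dim_row (case l of (m, z) \<Rightarrow> jordan_block m z)) (dim_row (case l of (m, z) \<Rightarrow> jordan_block m z))"
    "(case l of (m, z) \<Rightarrow> jordan_block m z) * Y = 1\<^sub>m (dim_row (case l of (m, z) \<Rightarrow> jordan_block m z))"
  then show "l \<in> {(m, z). z \<noteq> 0}"
    using jordan_block_0_not_right_invertible[of Y "fst l"] by (cases l) auto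
next
  fix l :: "nat \<times> complex"
  assume "l \<in> {(m, z). m > 0} \<inter> {(m, z). z \<noteq> 0}"
  then obtain m z where l: "l = (m, z)" "z \<noteq> 0" by auto
  \<comment> \<open>The equation amounts to \<open>z * z = 1\<close>.\<close>
  have eq: "inverse z = z \<longleftrightarrow> z = 1 \<or> z = - 1"
    using l(2) by (metis divide_inverse divide_self_if inverse_1 inverse_minus_eq square_eq_1_iff)
  have refl: "similar_mat (jordan_block m x) (jordan_block m x)" for x :: complex
    by (rule similar_mat_refl[OF jordan_block_carrier])
  show "inverse_similar (case l of (m, z) \<Rightarrow> jordan_block m z)
      (case apsnd inverse l of (m, z) \<Rightarrow> jordan_block m z)"
    using inverse_similar_jordan_block l by simp
  show "pair_C (case l of (m, z) \<Rightarrow> jordan_block m z)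
      (case apsnd inverse l of (m, z) \<Rightarrow> jordan_block m z)" if "apsnd inverse l \<noteq> l"
    using that l eq refl unfolding pair_C_def by auto
  show "single_C (case l of (m, z) \<Rightarrow> jordan_block m z)" if "apsnd inverse l = l"
    using that l eq refl unfolding single_C_def by auto
qed auto

lemma reversible_H_iff:
  assumes "A \<in> carrier (GL n)" "jordan_form blocks_H A Bs"
  shows "reversible (GL n) A \<longleftrightarrow> pairs_and_singletons pair_H single_H Bs"
proof (rule reversible_iff_pairs_and_singletons[where
      B = "\<lambda>(m, z). jordan_block m (quat_of_complex z)" and L = jordan_labels and
      \<sigma> = "\<lambda>(m, z). (m, inverse (cnj z))" and I = "{(m, z). z \<noteq> 0}"])
  show "A \<in> carrier (GL n)"
    "jordan_form ((\<lambda>(m, z). jordan_block m (quat_of_complex z)) ` jordan_labels) A Bs"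
    using assms by (simp_all add: blocks_H_eq)
next
  have *: "inverse_similar X Y" if "similar_mat X X'" "similar_mat Y Y'" "inverse_similar X' Y'"
    for X Y X' Y' :: "quat mat"
    using that similar_mat_sym inverse_similar_trans inverse_similar_trans_left by blast
  show "inverse_similar X Y" if "pair_H X Y" for X Y
    using that * inverse_similar_jordan_block_quat unfolding pair_H_def by metis
  show "inverse_similar X X" if X: "single_H X" for X
  proof -
    obtain a m where a: "a \<noteq> 0" "cmod a = 1" "similar_mat X (jordan_block m (quat_of_complex a))"
      using X unfolding single_H_def by blast
    \<comment> \<open>The inverse block has the conjugate eigenvalue, and conjugation by
      \<open>j\<close> leads back to the block itself.\<close>
    then have "inverse a = cnj a" using inverse_cnj_eq_iff[of "cnj a"] by simp
    then show ?thesis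
      using *[OF a(3,3)] inverse_similar_jordan_block_quat[OF a(1)] similar_jordan_block_quat_cnj
        inverse_similar_trans by metis
  qed
next
  fix l :: "nat \<times> complex" and Y :: "quat mat"
  assume "l \<in> jordan_labels"
    "Y \<in> carrier_mat (dim_row (case l of (m, z) \<Rightarrow> jordan_block m (quat_of_complex z)))
      (dim_row (case l of (m, z) \<Rightarrow> jordan_block m (quat_of_complex z)))"
    "(case l of (m, z) \<Rightarrow> jordan_block m (quat_of_complex z)) * Y =
      1\<^sub>m (dim_row (case l of (m, z) \<Rightarrow> jordan_block m (quat_of_complex z)))"
  then show "l \<in> {(m, z). z \<noteq> 0}"
    using jordan_block_0_not_right_invertible[of Y "fst l"] by (cases l) (auto simp: jordan_labels_def)
next
  fix l :: "nat \<times> complex"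
  assume "l \<in> jordan_labels \<inter> {(m, z). z \<noteq> 0}"
  then obtain m z where l: "l = (m, z)" "z \<noteq> 0" "Im z \<ge> 0" by (auto simp: jordan_labels_def)
  have refl: "similar_mat (jordan_block m x) (jordan_block m x)" for x :: quat
    by (rule similar_mat_refl[OF jordan_block_carrier])
  \<comment> \<open>\<open>pair_H\<close> names the partner by \<open>1/z\<close>, whose imaginary
    part may be negative; its normalised label is \<open>1/cnj z\<close>.\<close>
  have sim: "similar_mat (jordan_block m (quat_of_complex (inverse (cnj z))))
      (jordan_block m (quat_of_complex (inverse z)))"
    using similar_jordan_block_quat_cnj[of m "inverse z"] by simp
  show "inverse_similar (case l of (m, z) \<Rightarrow> jordan_block m (quat_of_complex z))
      (case case l of (m, z) \<Rightarrow> (m, inverse (cnj z)) of (m, z) \<Rightarrow> jordan_block m (quat_of_complex z))"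
    using inverse_similar_trans[OF inverse_similar_jordan_block_quat[OF l(2)] similar_mat_sym[OF sim]]
    by (simp add: l(1))
  show "pair_H (case l of (m, z) \<Rightarrow> jordan_block m (quat_of_complex z))
      (case case l of (m, z) \<Rightarrow> (m, inverse (cnj z)) of (m, z) \<Rightarrow> jordan_block m (quat_of_complex z))"
    if "(case l of (m, z) \<Rightarrow> (m, inverse (cnj z))) \<noteq> l"
    using that l inverse_cnj_eq_iff[OF l(2)] refl sim unfolding pair_H_def by auto
  show "single_H (case l of (m, z) \<Rightarrow> jordan_block m (quat_of_complex z))"
    if "(case l of (m, z) \<Rightarrow> (m, inverse (cnj z))) = l"
    using that l inverse_cnj_eq_iff[OF l(2)] refl unfolding single_H_def by auto
qed (use similar_quat_jordan_blocks_unique in \<open>auto simp: jordan_labels_def\<close>)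

theorem theorem5p1:
  fixes n :: nat
  shows
    "(\<forall>(A :: real mat) Bs. A \<in> carrier (GL n) \<and> jordan_form blocks_R A Bs \<longrightarrow>
        (reversible (GL n) A \<longleftrightarrow> pairs_and_singletons pair_R single_R Bs)) \<and>
     (\<forall>(A :: complex mat) Bs. A \<in> carrier (GL n) \<and> jordan_form blocks_C A Bs \<longrightarrow>
        (reversible (GL n) A \<longleftrightarrow> pairs_and_singletons pair_C single_C Bs)) \<and>
     (\<forall>(A :: quat mat) Bs. A \<in> carrier (GL n) \<and> jordan_form blocks_H A Bs \<longrightarrow>
        (reversible (GL n) A \<longleftrightarrow> pairs_and_singletons pair_H single_H Bs))"
  using reversible_R_iff reversible_C_iff reversible_H_iff by blast

end
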